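(* Let $T>0$, $I=[-T,T]$, and let $m,M\in\mathbb{R}$ be such that the periodic problem $$v''(t)+m\,v(-t)+M\,v([t])=\sigma(t)\ \text{ a.e. } t\in I,\qquad v(T)=v(-T),\quad v'(-T)=v'(T)$$ has a unique solution for every $\sigma\in\mathcal{L}^1(I)$. Then its Green's function $H_{m,M}$ satisfies: 1. For each fixed $s$, $H_{m,M}(\cdot,s)$ is well-defined and continuous for all $t\in I$, of class $C^1$ for all $t\in I$, $t\neq s$, and of class $C^2$ for all $t\in I$, $t\neq s$ and $t\notin D\setminus\{0\}$. 2. For each fixed $t$, $H_{m,M}(t,\cdot)$ is well-defined and continuous for all $s\in I$. Moreover, $H_{m,M}(t,\cdot)$ is of class $C^2$ for all $s\in I$, $s\notin D_t$. 3. For each $s\in(-T,T)$, the function $t\mapsto H_{m,M}(t,s)$ satisfies $\frac{\partial^2}{\partial t^2}H_{m,M}(t,s)+m\,H_{m,M}(-t,s)+M\,H_{m,M}([t],s)=0$ for all $t\in I$, $t\neq s$ and $t\notin D\setminus\{0\}$. 4. For each $t\in(-T,T)$, $t\notin D$, the lateral limits $\frac{\partial}{\partial t}H_{m,M}(t^-,t)=\frac{\partial}{\partial t}H_{m,M}(t,t^+)$ and $\frac{\partial}{\partial t}H_{m,M}(t,t^-)=\frac{\partial}{\partial t}H_{m,M}(t^+,t)$ exist and are real (with the stated equalities). Furthermore, $$\frac{\partial}{\partial t}H_{m,M}(t^+,t)-\frac{\partial}{\partial t}H_{m,M}(t^-,t)=\frac{\partial}{\partial t}H_{m,M}(t,t^-)-\frac{\partial}{\partial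 t}H_{m,M}(t,t^+)=1.$$ 5. For each $s\in(-T,T)$: $H_{m,M}(T,s)=H_{m,M}(-T,s)$ and $\frac{\partial}{\partial t}H_{m,M}(T,s)=\frac{\partial}{\partial t}H_{m,M}(-T,s)$. 6. For each $t\in(-T,T)$: $H_{m,M}(t,T)=H_{m,M}(t,-T)$ and $\frac{\partial}{\partial s}H_{m,M}(t,T)=\frac{\partial}{\partial s}H_{m,M}(t,-T)$. 7. $H_{m,M}(t,s)=H_{m,M}(-t,-s)$ for all $t,s\in I$. 8. $\frac{\partial^2}{\partial s^2}H_{m,M}(t,s)+m\,H_{m,M}(t,-s)=0$ for all $t,s\in I$, $s\notin D_t$.
   Context: The function $[t]$ is truncation towards zero: for $n\in\{0,1,2,\ldots\}$, $[t]=n$ if $t\in[n,n+1)$ and $[t]=-n$ if $t\in(-n-1,-n]$; in particular $[t]=0$ on $(-1,1)$. A solution of the problem is a function $v\in C^1(I)$ with $v'$ absolutely continuous on $I$ that satisfies the equation a.e. and the boundary conditions. The Green's function $H_{m,M}:I\times I\to\mathbb{R}$ is the kernel (continuous representative) such that for every $\sigma\in\mathcal{L}^1(I)$ the unique solution is $v(t)=\int_{-T}^{T}H_{m,M}(t,s)\sigma(s)\,ds$. Sets: $D=\{-[T],\ldots,0,\ldots,[T]\}$ (integers between $-[T]$ and $[T]$), and $D_t=D\cup\{t,-t\}$ for $t\in I$. Notation: $\frac{\partial}{\partial t}H_{m,M}(t^{\pm},t)=\lim_{\tau\to t^{\pm}}\frac{\partial H_{m,M}}{\partial t}(\tau,t)$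 (derivative in the first variable) and $\frac{\partial}{\partial t}H_{m,M}(t,t^{\pm})=\lim_{s\to t^{\pm}}\frac{\partial H_{m,M}}{\partial t}(t,s)$. Derivatives at endpoints of $I$ are one-sided. *)

theory Defs
  imports "HOL-Analysis.Analysis"
begin

definition trunc :: "real \<Rightarrow> int" where
  "trunc t = (if t \<ge> 0 then \<lfloor>t\<rfloor> else \<lceil>t\<rceil>)"

definition abs_continuous_on_ivl :: "real \<Rightarrow> real \<Rightarrow> (real \<Rightarrow> real) \<Rightarrow> bool" where
  "abs_continuous_on_ivl a b f \<longleftrightarrow>
    (\<forall>\<epsilon>>0. \<exists>\<delta>>0. \<forall>(n::nat) (x::nat \<Rightarrow> real) (y::nat \<Rightarrow> real).
      (\<forall>k<n. a \<le> x k \<and> x k \<le> y k \<and> y k \<le> b) \<and>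
      disjoint_family_on (\<lambda>k. {x k<..<y k}) {..<n} \<and>
      (\<Sum>k<n. y k - x k) < \<delta> \<longrightarrow>
      (\<Sum>k<n. \<bar>f (y k) - f (x k)\<bar>) < \<epsilon>)"

text \<open>A solution is a total function of which only the restriction to \<open>[-T, T]\<close> matters; all
  derivatives are taken within this interval, hence are one-sided at the endpoints. Continuity of
  \<open>v'\<close> is part of its absolute continuity.\<close>

definition is_solution ::
    "real \<Rightarrow> real \<Rightarrow> real \<Rightarrow> (real \<Rightarrow> real) \<Rightarrow> (real \<Rightarrow> real) \<Rightarrow> bool" where
  "is_solution T m M \<sigma> v \<longleftrightarrow>
    (\<exists>v'. (\<forall>t\<in>{-T..T}. (v has_real_derivative v' t) (at t within {-T..T})) \<and>
          abs_continuous_on_ivl (-T) T v' \<and>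
          (AE t\<in>{-T..T} in lebesgue. \<exists>d. (v' has_real_derivative d) (at t within {-T..T}) \<and>
             d + m * v (- t) + M * v (of_int (trunc t)) = \<sigma> t) \<and>
          v T = v (-T) \<and> v' (-T) = v' T)"

definition uniquely_solvable :: "real \<Rightarrow> real \<Rightarrow> real \<Rightarrow> bool" where
  "uniquely_solvable T m M \<longleftrightarrow>
    (\<forall>\<sigma>. \<sigma> absolutely_integrable_on {-T..T} \<longrightarrow>
      (\<exists>v. is_solution T m M \<sigma> v \<and>
        (\<forall>w. is_solution T m M \<sigma> w \<longrightarrow> (\<forall>t\<in>{-T..T}. w t = v t))))"

text \<open>For each \<open>t\<close> the integral formula determines the section \<open>H t\<close> only up to a null set;
  continuity of these sections selects the representative. Continuity in the first variable is
  not part of the definition.\<close>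

definition is_greens_function ::
    "real \<Rightarrow> real \<Rightarrow> real \<Rightarrow> (real \<Rightarrow> real \<Rightarrow> real) \<Rightarrow> bool" where
  "is_greens_function T m M H \<longleftrightarrow>
    (\<forall>t\<in>{-T..T}. continuous_on {-T..T} (H t)) \<and>
    (\<forall>\<sigma>. \<sigma> absolutely_integrable_on {-T..T} \<longrightarrow>
      is_solution T m M \<sigma> (\<lambda>t. LINT s:{-T..T}|lebesgue. H t s * \<sigma> s))"

definition D_set :: "real \<Rightarrow> real set" where
  "D_set T = of_int ` {- trunc T..trunc T}"

definition D_set_at :: "real \<Rightarrow> real \<Rightarrow> real set" where
  "D_set_at T t = D_set T \<union> {t, -t}"

definition deriv_on :: "real set \<Rightarrow> (real \<Rightarrow> real) \<Rightarrow> real \<Rightarrow> real" where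
  "deriv_on I f t = vector_derivative f (at t within I)"

text \<open>Regularity at the points of a relatively open subset \<open>S\<close> of the interval \<open>I\<close>. The values of
  \<open>deriv_on I f\<close> at points of \<open>I - S\<close>, where \<open>f\<close> need not be differentiable, are irrelevant for
  this.\<close>

definition C1_at_points :: "real set \<Rightarrow> real set \<Rightarrow> (real \<Rightarrow> real) \<Rightarrow> bool" where
  "C1_at_points I S f \<longleftrightarrow>
    (\<forall>t\<in>S. f differentiable (at t within I)) \<and> continuous_on S (deriv_on I f)"

definition C2_at_points :: "real set \<Rightarrow> real set \<Rightarrow> (real \<Rightarrow> real) \<Rightarrow> bool" where
  "C2_at_points I S f \<longleftrightarrow> C1_at_points I S f \<and> C1_at_points I S (deriv_on I f)"

definition partial_t :: "real \<Rightarrow> (real \<Rightarrow> real \<Rightarrow> real) \<Rightarrow> real \<Rightarrow> real \<Rightarrow> real" where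
  "partial_t T H t s = deriv_on {-T..T} (\<lambda>\<tau>. H \<tau> s) t"

definition partial_s :: "real \<Rightarrow> (real \<Rightarrow> real \<Rightarrow> real) \<Rightarrow> real \<Rightarrow> real \<Rightarrow> real" where
  "partial_s T H t s = deriv_on {-T..T} (\<lambda>r. H t r) s"

end

theory Submission
  imports Defs
begin

text \<open>The equation \<open>v''(t) + m v(-t) = f\<close> has an explicit fundamental solution \<open>kern\<close>. It
  violates the periodicity conditions and ignores the term \<open>M v([t])\<close>, but on \<open>[-T, T]\<close> both
  defects are finite-dimensional: two boundary values and the values of \<open>v\<close> at the integers. Unique
  solvability provides, for each of these data, a solution \<open>w\<close> that repairs the corresponding defect,
  so that the Green's function is \<open>kern t s\<close> plus a finite sum of products \<open>w t * k s\<close>, where the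
  \<open>w\<close> are solutions of the equation with piecewise constant right-hand sides and the \<open>k\<close> are
  values of the kernel. All regularity claims are read off from this formula. That it represents
  the solutions is Green's identity for the absolutely continuous function \<open>v'\<close>.\<close>

section \<open>Absolutely continuous functions\<close>

text \<open>The kernel comes from splitting \<open>v\<close> into its even part \<open>e\<close> and
  odd part \<open>o\<close>, which turns the reflection into the decoupled operators
  \<open>e'' + m e\<close> and \<open>o'' - m o\<close>. For nonzero \<open>m\<close> one has a
  trigonometric and the other a hyperbolic fundamental solution; half their sum sits at
  \<open>t - s\<close>, half their difference at \<open>t + s\<close>. It is never checked directly
  that the integral operator produces a solution. Unique solvability supplies the periodic solution
  \<open>v\<close> for a given \<open>\<sigma>\<close>, and it suffices that the kernel integrated
  against \<open>\<sigma>\<close> reproduces \<open>v t\<close>. In this computation the boundary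
  values of \<open>v\<close> and \<open>v'\<close> and the values of \<open>v\<close> at the
  integers appear as unwanted terms. Their coefficients vanish because correcting a homogeneous
  solution, or the response to the indicator of one truncation level, must again give the unique
  periodic solution. The same identities yield the periodicity in \<open>s\<close>, which the form
  of the kernel does not show.\<close>

lemma abs_continuousD:
  assumes "abs_continuous_on_ivl a b f" "\<epsilon> > 0"
  obtains \<delta> where "\<delta> > 0"
    "\<And>(n::nat) x y. (\<And>k. k < n \<Longrightarrow> a \<le> x k \<and> x k \<le> y k \<and> y k \<le> b) \<Longrightarrow>
      disjoint_family_on (\<lambda>k. {x k<..<y k}) {..<n} \<Longrightarrow> (\<Sum>k<n. y k - x k) < \<delta> \<Longrightarrow>
      (\<Sum>k<n. \<bar>f (y k) - f (x k)\<bar>) < \<epsilon>"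
proof -
  have "\<exists>\<delta>>0. \<forall>(n::nat) x y. (\<forall>k<n. a \<le> x k \<and> x k \<le> y k \<and> y k \<le> b) \<and>
      disjoint_family_on (\<lambda>k. {x k<..<y k}) {..<n} \<and> (\<Sum>k<n. y k - x k) < \<delta> \<longrightarrow>
      (\<Sum>k<n. \<bar>f (y k) - f (x k)\<bar>) < \<epsilon>"
    by (rule assms(1)[unfolded abs_continuous_on_ivl_def, rule_format, OF assms(2)])
  then show thesis
    by (elim exE conjE) (rule that, assumption, simp)
qed

lemma abs_continuous_subinterval:
  assumes "abs_continuous_on_ivl a b f" "a \<le> c" "d \<le> b"
  shows "abs_continuous_on_ivl c d f"
  unfolding abs_continuous_on_ivl_def
proof (intro allI impI)
  fix \<epsilon> :: real assume "\<epsilon> > 0"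
  then obtain \<delta> where "\<delta> > 0" and *:
    "\<And>(n::nat) x y. (\<And>k. k < n \<Longrightarrow> a \<le> x k \<and> x k \<le> y k \<and> y k \<le> b) \<Longrightarrow>
      disjoint_family_on (\<lambda>k. {x k<..<y k}) {..<n} \<Longrightarrow> (\<Sum>k<n. y k - x k) < \<delta> \<Longrightarrow>
      (\<Sum>k<n. \<bar>f (y k) - f (x k)\<bar>) < \<epsilon>"
    by (rule abs_continuousD[OF assms(1)]) (rule that, assumption, blast)
  show "\<exists>\<delta>>0. \<forall>(n::nat) x y. (\<forall>k<n. c \<le> x k \<and> x k \<le> y k \<and> y k \<le> d) \<and>
      disjoint_family_on (\<lambda>k. {x k<..<y k}) {..<n} \<and> (\<Sum>k<n. y k - x k) < \<delta> \<longrightarrow>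
      (\<Sum>k<n. \<bar>f (y k) - f (x k)\<bar>) < \<epsilon>"
    by (rule exI[of _ \<delta>]) (use \<open>\<delta> > 0\<close> assms(2,3) in \<open>force intro!: *\<close>)
qed

text \<open>Only increments enter the definition, so a bound on increments transfers absolute
  continuity. Lipschitz functions are compared with the identity, linear combinations and products
  with their constituents.\<close>

lemma abs_continuous_dominated:
  assumes f: "abs_continuous_on_ivl a b f" and g: "abs_continuous_on_ivl a b g"
    and "A \<ge> 0" "B \<ge> 0"
    and le: "\<And>x y. a \<le> x \<Longrightarrow> x \<le> y \<Longrightarrow> y \<le> b \<Longrightarrow> \<bar>h y - h x\<bar> \<le> A * \<bar>f y - f x\<bar> + B * \<bar>g y - g x\<bar>"
  shows "abs_continuous_on_ivl a b h"
  unfolding abs_continuous_on_ivl_def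
proof (intro allI impI)
  fix \<epsilon> :: real assume "\<epsilon> > 0"
  \<comment> \<open>The \<open>+ 1\<close> keeps the quotient meaningful for
    \<open>A = B = 0\<close> and supplies the strict inequality at the end.\<close>
  define e where "e = \<epsilon> / (A + B + 1)"
  have "e > 0" using \<open>\<epsilon> > 0\<close> assms by (simp add: e_def)
  obtain \<delta>1 where "\<delta>1 > 0" and 1:
    "\<And>(n::nat) x y. (\<And>k. k < n \<Longrightarrow> a \<le> x k \<and> x k \<le> y k \<and> y k \<le> b) \<Longrightarrow>
      disjoint_family_on (\<lambda>k. {x k<..<y k}) {..<n} \<Longrightarrow> (\<Sum>k<n. y k - x k) < \<delta>1 \<Longrightarrow>
      (\<Sum>k<n. \<bar>f (y k) - f (x k)\<bar>) < e"
    by (rule abs_continuousD[OF f \<open>e > 0\<close>]) (rule that, assumption, blast)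
  obtain \<delta>2 where "\<delta>2 > 0" and 2:
    "\<And>(n::nat) x y. (\<And>k. k < n \<Longrightarrow> a \<le> x k \<and> x k \<le> y k \<and> y k \<le> b) \<Longrightarrow>
      disjoint_family_on (\<lambda>k. {x k<..<y k}) {..<n} \<Longrightarrow> (\<Sum>k<n. y k - x k) < \<delta>2 \<Longrightarrow>
      (\<Sum>k<n. \<bar>g (y k) - g (x k)\<bar>) < e"
    by (rule abs_continuousD[OF g \<open>e > 0\<close>]) (rule that, assumption, blast)
  show "\<exists>\<delta>>0. \<forall>(n::nat) x y. (\<forall>k<n. a \<le> x k \<and> x k \<le> y k \<and> y k \<le> b) \<and>
      disjoint_family_on (\<lambda>k. {x k<..<y k}) {..<n} \<and> (\<Sum>k<n. y k - x k) < \<delta> \<longrightarrow>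
      (\<Sum>k<n. \<bar>h (y k) - h (x k)\<bar>) < \<epsilon>"
  proof (intro exI[of _ "min \<delta>1 \<delta>2"] conjI allI impI)
    show "min \<delta>1 \<delta>2 > 0" using \<open>\<delta>1 > 0\<close> \<open>\<delta>2 > 0\<close> by simp
    fix n :: nat and x y :: "nat \<Rightarrow> real"
    assume H: "(\<forall>k<n. a \<le> x k \<and> x k \<le> y k \<and> y k \<le> b) \<and>
      disjoint_family_on (\<lambda>k. {x k<..<y k}) {..<n} \<and> (\<Sum>k<n. y k - x k) < min \<delta>1 \<delta>2"
    have "(\<Sum>k<n. \<bar>h (y k) - h (x k)\<bar>) \<le> (\<Sum>k<n. A * \<bar>f (y k) - f (x k)\<bar> + B * \<bar>g (y k) - g (x k)\<bar>)"
      by (intro sum_mono le) (use H in auto)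
    also have "\<dots> = A * (\<Sum>k<n. \<bar>f (y k) - f (x k)\<bar>) + B * (\<Sum>k<n. \<bar>g (y k) - g (x k)\<bar>)"
      by (simp add: sum.distrib sum_distrib_left)
    also have "\<dots> \<le> A * e + B * e"
      using 1[of n x y] 2[of n x y] H \<open>A \<ge> 0\<close> \<open>B \<ge> 0\<close> by (intro add_mono mult_left_mono) auto
    also have "A * e + B * e < (A + B + 1) * e"
      using \<open>e > 0\<close> by (simp add: algebra_simps)
    also have "\<dots> = \<epsilon>"
      using assms(3,4) by (simp add: e_def)
    finally show "(\<Sum>k<n. \<bar>h (y k) - h (x k)\<bar>) < \<epsilon>" .
  qed
qed

lemma abs_continuous_ident: "abs_continuous_on_ivl a b (\<lambda>x. x)"
  unfolding abs_continuous_on_ivl_def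
proof (intro allI impI)
  fix \<epsilon> :: real assume "\<epsilon> > 0"
  show "\<exists>\<delta>>0. \<forall>(n::nat) x y. (\<forall>k<n. a \<le> x k \<and> x k \<le> y k \<and> y k \<le> b) \<and>
      disjoint_family_on (\<lambda>k. {x k<..<y k}) {..<n} \<and> (\<Sum>k<n. y k - x k) < \<delta> \<longrightarrow>
      (\<Sum>k<n. \<bar>y k - x k\<bar>) < \<epsilon>"
  proof (intro exI[of _ \<epsilon>] conjI allI impI)
    fix n :: nat and x y :: "nat \<Rightarrow> real"
    assume H: "(\<forall>k<n. a \<le> x k \<and> x k \<le> y k \<and> y k \<le> b) \<and>
      disjoint_family_on (\<lambda>k. {x k<..<y k}) {..<n} \<and> (\<Sum>k<n. y k - x k) < \<epsilon>"
    have "(\<Sum>k<n. \<bar>y k - x k\<bar>) = (\<Sum>k<n. y k - x k)" by (rule sum.cong) (use H in auto)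
    then show "(\<Sum>k<n. \<bar>y k - x k\<bar>) < \<epsilon>" using H by simp
  qed (rule \<open>\<epsilon> > 0\<close>)
qed

lemma abs_continuous_lipschitz:
  assumes "L-lipschitz_on {a..b} f"
  shows "abs_continuous_on_ivl a b f"
proof (rule abs_continuous_dominated[OF abs_continuous_ident abs_continuous_ident])
  show "L \<ge> 0" using assms lipschitz_on_nonneg by blast
  show "\<bar>f y - f x\<bar> \<le> L * \<bar>y - x\<bar> + 0 * \<bar>y - x\<bar>" if "a \<le> x" "x \<le> y" "y \<le> b" for x y
    using lipschitz_onD[OF assms, of y x] that by (simp add: dist_real_def)
qed simp

lemma abs_continuous_lincomb:
  assumes "abs_continuous_on_ivl a b f" "abs_continuous_on_ivl a b g"
  shows "abs_continuous_on_ivl a b (\<lambda>x. c * f x + d * g x)"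
proof (rule abs_continuous_dominated[OF assms, of "\<bar>c\<bar>" "\<bar>d\<bar>"])
  fix x y :: real
  have "c * f y + d * g y - (c * f x + d * g x) = c * (f y - f x) + d * (g y - g x)"
    by (simp add: algebra_simps)
  then show "\<bar>c * f y + d * g y - (c * f x + d * g x)\<bar> \<le> \<bar>c\<bar> * \<bar>f y - f x\<bar> + \<bar>d\<bar> * \<bar>g y - g x\<bar>"
    by (metis abs_mult abs_triangle_ineq)
qed auto

lemma abs_continuous_imp_continuous_on:
  assumes "abs_continuous_on_ivl a b f"
  shows "continuous_on {a..b} f"
  unfolding continuous_on_iff
proof (intro ballI allI impI)
  fix x \<epsilon> :: real assume x: "x \<in> {a..b}" and "\<epsilon> > 0"
  obtain \<delta> where "\<delta> > 0" and *:
    "\<And>(n::nat) x y. (\<And>k. k < n \<Longrightarrow> a \<le> x k \<and> x k \<le> y k \<and> y k \<le> b) \<Longrightarrow>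
      disjoint_family_on (\<lambda>k. {x k<..<y k}) {..<n} \<Longrightarrow> (\<Sum>k<n. y k - x k) < \<delta> \<Longrightarrow>
      (\<Sum>k<n. \<bar>f (y k) - f (x k)\<bar>) < \<epsilon>"
    by (rule abs_continuousD[OF assms \<open>\<epsilon> > 0\<close>]) (rule that, assumption, blast)
  have "\<bar>f v - f u\<bar> < \<epsilon>" if "a \<le> u" "u \<le> v" "v \<le> b" "v - u < \<delta>" for u v
    using *[of "Suc 0" "\<lambda>_. u" "\<lambda>_. v"] that by (auto simp: disjoint_family_on_def)
  then show "\<exists>d>0. \<forall>x'\<in>{a..b}. dist x' x < d \<longrightarrow> dist (f x') (f x) < \<epsilon>"
    using \<open>\<delta> > 0\<close> x
    by (intro exI[of _ \<delta>]) (metis abs_minus_commute atLeastAtMost_iff dist_real_def linear abs_of_nonneg diff_ge_0_iff_ge)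
qed

lemma abs_continuous_mult:
  assumes f: "abs_continuous_on_ivl a b f" and g: "abs_continuous_on_ivl a b g"
  shows "abs_continuous_on_ivl a b (\<lambda>x. f x * g x)"
proof -
  have "bounded (f ` {a..b})" "bounded (g ` {a..b})"
    using assms abs_continuous_imp_continuous_on compact_continuous_image compact_imp_bounded
      compact_Icc by blast+
  then obtain A B where A: "\<And>x. x \<in> {a..b} \<Longrightarrow> \<bar>f x\<bar> \<le> A" and B: "\<And>x. x \<in> {a..b} \<Longrightarrow> \<bar>g x\<bar> \<le> B"
    unfolding bounded_iff by (metis image_eqI real_norm_def)
  show ?thesis
  proof (rule abs_continuous_dominated[OF f g, of "\<bar>B\<bar>" "\<bar>A\<bar>"])
    fix x y assume xy: "a \<le> x" "x \<le> y" "y \<le> b"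
    have "f y * g y - f x * g x = g y * (f y - f x) + f x * (g y - g x)" by (simp add: algebra_simps)
    also have "\<bar>\<dots>\<bar> \<le> \<bar>g y\<bar> * \<bar>f y - f x\<bar> + \<bar>f x\<bar> * \<bar>g y - g x\<bar>"
      by (metis abs_mult abs_triangle_ineq)
    also have "\<dots> \<le> \<bar>B\<bar> * \<bar>f y - f x\<bar> + \<bar>A\<bar> * \<bar>g y - g x\<bar>"
      using A[of x] B[of y] xy by (intro add_mono mult_right_mono) auto
    finally show "\<bar>f y * g y - f x * g x\<bar> \<le> \<bar>B\<bar> * \<bar>f y - f x\<bar> + \<bar>A\<bar> * \<bar>g y - g x\<bar>" .
  qed auto
qed

text \<open>Reflection swaps the endpoints of every interval but preserves lengths and disjointness,
  so the original \<open>\<delta>\<close> serves again.\<close>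

lemma abs_continuous_reflect:
  assumes "abs_continuous_on_ivl a b f"
  shows "abs_continuous_on_ivl (-b) (-a) (\<lambda>x. f (- x))"
  unfolding abs_continuous_on_ivl_def
proof (intro allI impI)
  fix \<epsilon> :: real assume "\<epsilon> > 0"
  obtain \<delta> where "\<delta> > 0" and *:
    "\<And>(n::nat) x y. (\<And>k. k < n \<Longrightarrow> a \<le> x k \<and> x k \<le> y k \<and> y k \<le> b) \<Longrightarrow>
      disjoint_family_on (\<lambda>k. {x k<..<y k}) {..<n} \<Longrightarrow> (\<Sum>k<n. y k - x k) < \<delta> \<Longrightarrow>
      (\<Sum>k<n. \<bar>f (y k) - f (x k)\<bar>) < \<epsilon>"
    by (rule abs_continuousD[OF assms \<open>\<epsilon> > 0\<close>]) (rule that, assumption, blast)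
  show "\<exists>\<delta>>0. \<forall>(n::nat) x y. (\<forall>k<n. - b \<le> x k \<and> x k \<le> y k \<and> y k \<le> - a) \<and>
      disjoint_family_on (\<lambda>k. {x k<..<y k}) {..<n} \<and> (\<Sum>k<n. y k - x k) < \<delta> \<longrightarrow>
      (\<Sum>k<n. \<bar>f (- y k) - f (- x k)\<bar>) < \<epsilon>"
  proof (intro exI[of _ \<delta>] conjI allI impI)
    fix n :: nat and x y :: "nat \<Rightarrow> real"
    assume H: "(\<forall>k<n. - b \<le> x k \<and> x k \<le> y k \<and> y k \<le> - a) \<and>
      disjoint_family_on (\<lambda>k. {x k<..<y k}) {..<n} \<and> (\<Sum>k<n. y k - x k) < \<delta>"
    have "{- y k<..<- x k} = uminus ` {x k<..<y k}" for k by simp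
    then have "disjoint_family_on (\<lambda>k. {- y k<..<- x k}) {..<n}"
      using H unfolding disjoint_family_on_def by (simp add: min_def max_def) (smt (verit))
    then have "(\<Sum>k<n. \<bar>f (- x k) - f (- y k)\<bar>) < \<epsilon>"
      using H by (intro *) auto
    then show "(\<Sum>k<n. \<bar>f (- y k) - f (- x k)\<bar>) < \<epsilon>" by (simp add: abs_minus_commute)
  qed (rule \<open>\<delta> > 0\<close>)
qed

text \<open>Tagged divisions are finite sets of pairs, while the definition speaks of families
  indexed by an initial segment of the naturals; an enumeration bridges the two.\<close>

lemma abs_continuous_small_sum:
  assumes "abs_continuous_on_ivl a b f" "\<epsilon> > 0"
  obtains \<delta> where "\<delta> > 0"
    "\<And>(p :: 'i set) l u. finite p \<Longrightarrow> (\<And>i. i \<in> p \<Longrightarrow> a \<le> l i \<and> l i \<le> u i \<and> u i \<le> b) \<Longrightarrow>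
      disjoint_family_on (\<lambda>i. {l i<..<u i}) p \<Longrightarrow> (\<Sum>i\<in>p. u i - l i) < \<delta> \<Longrightarrow>
      (\<Sum>i\<in>p. \<bar>f (u i) - f (l i)\<bar>) < \<epsilon>"
proof -
  obtain \<delta> where "\<delta> > 0" and *:
    "\<And>(n::nat) x y. (\<And>k. k < n \<Longrightarrow> a \<le> x k \<and> x k \<le> y k \<and> y k \<le> b) \<Longrightarrow>
      disjoint_family_on (\<lambda>k. {x k<..<y k}) {..<n} \<Longrightarrow> (\<Sum>k<n. y k - x k) < \<delta> \<Longrightarrow>
      (\<Sum>k<n. \<bar>f (y k) - f (x k)\<bar>) < \<epsilon>"
    by (rule abs_continuousD[OF assms]) (rule that, assumption, blast)
  show thesis
  proof (rule that[OF \<open>\<delta> > 0\<close>])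
    fix p :: "'i set" and l u
    assume "finite p" and bd: "\<And>i. i \<in> p \<Longrightarrow> a \<le> l i \<and> l i \<le> u i \<and> u i \<le> b"
      and dj: "disjoint_family_on (\<lambda>i. {l i<..<u i}) p" and sm: "(\<Sum>i\<in>p. u i - l i) < \<delta>"
    obtain h where h: "bij_betw h {..<card p} p"
      using \<open>finite p\<close> ex_bij_betw_nat_finite lessThan_atLeast0 by metis
    have re: "(\<Sum>i\<in>p. F i) = (\<Sum>k<card p. F (h k))" for F :: "'i \<Rightarrow> real"
      using sum.reindex_bij_betw[OF h] by metis
    have hp: "h k \<in> p" if "k < card p" for k using h that by (auto simp: bij_betw_def)
    have "disjoint_family_on (\<lambda>k. {l (h k)<..<u (h k)}) {..<card p}"
      using dj h unfolding disjoint_family_on_def bij_betw_def inj_on_def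
      by (metis hp lessThan_iff)
    then show "(\<Sum>i\<in>p. \<bar>f (u i) - f (l i)\<bar>) < \<epsilon>"
      unfolding re using hp bd sm[unfolded re] by (intro *) auto
  qed
qed

text \<open>The Henstock integral needs no integrability of the derivative: a gauge that shrinks to an
  open set of small measure at the exceptional points turns absolute continuity into the estimate
  of the Riemann sums over the tags lying there.\<close>

theorem fundamental_theorem_abs_continuous:
  assumes ac: "abs_continuous_on_ivl a b f" and ab: "a \<le> b"
    and ae: "AE t\<in>{a..b} in lebesgue. (f has_real_derivative g t) (at t within {a..b})"
  shows "(g has_integral (f b - f a)) {a..b}"
proof -
  obtain N where N: "N \<in> null_sets lebesgue"
    and fg: "\<And>t. t \<in> {a..b} \<Longrightarrow> t \<notin> N \<Longrightarrow> (f has_real_derivative g t) (at t within {a..b})"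
  proof -
    from ae obtain N where "{t \<in> space lebesgue. \<not> (t \<in> {a..b} \<longrightarrow> (f has_real_derivative g t) (at t within {a..b}))} \<subseteq> N"
      "emeasure lebesgue N = 0" "N \<in> sets lebesgue" by (rule AE_E)
    then show thesis by (intro that[of N]) auto
  qed
  have neg: "negligible N" using N negligible_iff_null_sets by blast
  \<comment> \<open>Setting \<open>g\<close> to zero on the null set changes no integral and removes
    the Riemann terms at exceptional tags: only increments of \<open>f\<close> remain there.\<close>
  define g0 where "g0 t = (if t \<in> N then 0 else g t)" for t
  have "(g0 has_integral (f b - f a)) {a..b}"
    unfolding has_integral_real
  proof (intro allI impI)
    fix e :: real assume "e > 0"
    \<comment> \<open>The budget is \<open>\<epsilon> * (b - a)\<close> for tags outside
      \<open>N\<close>, one \<open>\<epsilon>\<close> for tags in \<open>N\<close>, and one in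
      reserve.\<close>
    define \<epsilon> where "\<epsilon> = e / (b - a + 2)"
    have "\<epsilon> > 0" using \<open>e > 0\<close> ab by (simp add: \<epsilon>_def)
    obtain \<delta> where "\<delta> > 0" and \<delta>:
      "\<And>(p :: (real \<times> real set) set) l u. finite p \<Longrightarrow> (\<And>i. i \<in> p \<Longrightarrow> a \<le> l i \<and> l i \<le> u i \<and> u i \<le> b) \<Longrightarrow>
        disjoint_family_on (\<lambda>i. {l i<..<u i}) p \<Longrightarrow> (\<Sum>i\<in>p. u i - l i) < \<delta> \<Longrightarrow>
        (\<Sum>i\<in>p. \<bar>f (u i) - f (l i)\<bar>) < \<epsilon>"
      using abs_continuous_small_sum[OF ac \<open>\<epsilon> > 0\<close>] by blast
    \<comment> \<open>Outer regularity: disjoint subintervals of \<open>U\<close> have total length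
      below \<open>\<delta>\<close>, so absolute continuity controls their increments.\<close>
    obtain U where "open U" "N \<subseteq> U" "U \<in> lmeasurable" and mU: "measure lebesgue U < \<delta>"
    proof -
      obtain U where U: "open U" "N \<subseteq> U" "U - N \<in> lmeasurable" "emeasure lebesgue (U - N) < ennreal \<delta>"
        using sets_lebesgue_outer_open[of N \<delta>] N \<open>\<delta> > 0\<close> by auto
      have "U = (U - N) \<union> N" using U by auto
      moreover have "N \<in> lmeasurable" using neg negligible_imp_measurable by blast
      ultimately have "U \<in> lmeasurable" using U(3) fmeasurable.Un by metis
      have "emeasure lebesgue U = emeasure lebesgue (U - N)"
        using N U(1) by (intro emeasure_Diff_null_set[symmetric]) auto
      then have "ennreal (measure lebesgue U) < ennreal \<delta>"
        using U(4) \<open>U \<in> lmeasurable\<close> by (simp add: emeasure_eq_measure2)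
      then show thesis using that[of U] U \<open>U \<in> lmeasurable\<close> \<open>\<delta> > 0\<close> by (simp add: ennreal_less_iff)
    qed
    have "\<exists>r>0. t \<in> {a..b} \<longrightarrow> t \<notin> N \<longrightarrow>
        (\<forall>y\<in>{a..b}. \<bar>y - t\<bar> < r \<longrightarrow> \<bar>f y - f t - g t * (y - t)\<bar> \<le> \<epsilon> * \<bar>y - t\<bar>)" for t
    proof (cases "t \<in> {a..b} \<and> t \<notin> N")
      case True
      then have "(f has_derivative (*) (g t)) (at t within {a..b})"
        using fg by (simp add: has_field_derivative_def)
      then show ?thesis
        using \<open>\<epsilon> > 0\<close> unfolding has_derivative_within_alt by (auto simp: real_norm_def)
    qed (auto intro: exI[of _ 1])
    then obtain r where r0: "\<And>t. r t > 0" and r: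
      "\<And>t y. t \<in> {a..b} \<Longrightarrow> t \<notin> N \<Longrightarrow> y \<in> {a..b} \<Longrightarrow> \<bar>y - t\<bar> < r t \<Longrightarrow>
        \<bar>f y - f t - g t * (y - t)\<bar> \<le> \<epsilon> * \<bar>y - t\<bar>" by metis
    \<comment> \<open>At tags in \<open>N\<close> fineness forces the whole interval into
      \<open>U\<close>; elsewhere it activates the differentiability estimate.\<close>
    define \<gamma> where "\<gamma> t = (if t \<in> N then U else ball t (r t))" for t
    have "gauge \<gamma>"
      unfolding gauge_def \<gamma>_def using \<open>open U\<close> \<open>N \<subseteq> U\<close> r0 by auto
    moreover have "norm ((\<Sum>(x,k)\<in>p. measure lborel k *\<^sub>R g0 x) - (f b - f a)) < e"
      if p: "p tagged_division_of {a..b}" and fine: "\<gamma> fine p" for p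
    proof -
      have fin: "finite p" using p by blast
      have ivl: "k = {Inf k..Sup k}" "Inf k \<le> x" "x \<le> Sup k" "a \<le> Inf k" "Sup k \<le> b"
        "measure lborel k = Sup k - Inf k" "x \<in> {a..b}" if xk: "(x, k) \<in> p" for x k
      proof -
        obtain l u where lu: "k = {l..u}" using tagged_division_ofD(4)[OF p xk] by auto
        have x: "x \<in> k" "k \<subseteq> {a..b}" using tagged_division_ofD(2,3)[OF p xk] by auto
        then have "l \<le> u" using lu by auto
        then have "Inf k = l" "Sup k = u" "measure lborel k = u - l" using lu by auto
        then show "k = {Inf k..Sup k}" "Inf k \<le> x" "x \<le> Sup k" "a \<le> Inf k" "Sup k \<le> b"
          "measure lborel k = Sup k - Inf k" "x \<in> {a..b}"
          using x lu \<open>l \<le> u\<close> by auto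
      qed
      define q where "q = {i \<in> p. fst i \<in> N}"
      define E where "E = (\<lambda>(x, k). \<bar>measure lborel k * g0 x - (f (Sup k) - f (Inf k))\<bar>)"
      have "finite q" "q \<subseteq> p" using fin by (auto simp: q_def)
      have dj: "disjoint_family_on (\<lambda>i. {Inf (snd i)<..<Sup (snd i)}) q"
        unfolding disjoint_family_on_def
      proof (intro ballI impI)
        fix i j assume ij: "i \<in> q" "j \<in> q" "i \<noteq> j"
        obtain x k y l where eq: "i = (x, k)" "j = (y, l)" by (metis surj_pair)
        have kl: "(x, k) \<in> p" "(y, l) \<in> p" using ij eq \<open>q \<subseteq> p\<close> by auto
        have "interior k \<inter> interior l = {}"
          using tagged_division_ofD(5)[OF p kl] ij eq by auto
        moreover have "interior k = {Inf k<..<Sup k}" "interior l = {Inf l<..<Sup l}"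
          using ivl(1)[OF kl(1)] ivl(1)[OF kl(2)] interior_atLeastAtMost_real by metis+
        ultimately show "{Inf (snd i)<..<Sup (snd i)} \<inter> {Inf (snd j)<..<Sup (snd j)} = {}"
          using eq by simp
      qed
      have qivl: "a \<le> Inf (snd i) \<and> Inf (snd i) \<le> Sup (snd i) \<and> Sup (snd i) \<le> b" if "i \<in> q" for i
      proof -
        have "(fst i, snd i) \<in> p" using that \<open>q \<subseteq> p\<close> by auto
        from ivl(2-5)[OF this] show ?thesis by simp
      qed
      have "(\<Sum>i\<in>q. Sup (snd i) - Inf (snd i)) = (\<Sum>i\<in>q. measure lebesgue {Inf (snd i)<..<Sup (snd i)})"
        using qivl by (intro sum.cong) auto
      moreover have "emeasure lebesgue {Inf (snd i)<..<Sup (snd i)} \<noteq> \<infinity>" if "i \<in> q" for i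
        using qivl[OF that] by simp
      ultimately have "(\<Sum>i\<in>q. Sup (snd i) - Inf (snd i)) = measure lebesgue (\<Union>i\<in>q. {Inf (snd i)<..<Sup (snd i)})"
        using measure_finite_Union[OF \<open>finite q\<close> _ dj, of lebesgue] by (simp add: image_subset_iff)
      also have "\<dots> \<le> measure lebesgue U"
      proof (rule measure_mono_fmeasurable)
        show "(\<Union>i\<in>q. {Inf (snd i)<..<Sup (snd i)}) \<subseteq> U"
        proof clarsimp
          fix x k z assume "(x, k) \<in> q" and z: "Inf k < z" "z < Sup k"
          then have "(x, k) \<in> p" "x \<in> N" by (auto simp: q_def)
          then have "k \<subseteq> U" using fineD[OF fine \<open>(x, k) \<in> p\<close>] \<open>x \<in> N\<close> by (simp add: \<gamma>_def)
          then show "z \<in> U" using ivl(1)[OF \<open>(x, k) \<in> p\<close>] z by (metis atLeastAtMost_iff less_imp_le subsetD)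
        qed
      qed (use \<open>U \<in> lmeasurable\<close> \<open>finite q\<close> in auto)
      finally have "(\<Sum>i\<in>q. Sup (snd i) - Inf (snd i)) < \<delta>" using mU by simp
      then have "(\<Sum>i\<in>q. \<bar>f (Sup (snd i)) - f (Inf (snd i))\<bar>) < \<epsilon>"
        using \<delta>[OF \<open>finite q\<close> qivl dj] by simp
      moreover have "(\<Sum>i\<in>q. E i) = (\<Sum>i\<in>q. \<bar>f (Sup (snd i)) - f (Inf (snd i))\<bar>)"
        by (rule sum.cong) (auto simp: E_def q_def g0_def)
      ultimately have Eq: "(\<Sum>i\<in>q. E i) < \<epsilon>" by simp
      have "(\<Sum>i\<in>p - q. E i) \<le> (\<Sum>i\<in>p - q. \<epsilon> * measure lborel (snd i))"
      proof (rule sum_mono, clarsimp)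
        fix x k assume xk: "(x, k) \<in> p" "(x, k) \<notin> q"
        then have "x \<notin> N" by (auto simp: q_def)
        have "k \<subseteq> ball x (r x)" using fineD[OF fine xk(1)] \<open>x \<notin> N\<close> by (simp add: \<gamma>_def)
        moreover have "Inf k \<in> k" "Sup k \<in> k"
          using ivl[OF xk(1)] by (metis atLeastAtMost_iff order.trans order_refl)+
        ultimately have "\<bar>Inf k - x\<bar> < r x" "\<bar>Sup k - x\<bar> < r x"
          by (auto simp: dist_real_def abs_minus_commute subset_iff)
        \<comment> \<open>Since \<open>x\<close> lies between the endpoints, the error bounds at
          \<open>Inf k\<close> and \<open>Sup k\<close> add up to \<open>\<epsilon>\<close> times
          the length of \<open>k\<close>.\<close>
        then have "\<bar>f (Sup k) - f x - g x * (Sup k - x)\<bar> \<le> \<epsilon> * (Sup k - x)"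
          "\<bar>f (Inf k) - f x - g x * (Inf k - x)\<bar> \<le> \<epsilon> * (x - Inf k)"
          using r[of x "Sup k"] r[of x "Inf k"] ivl[OF xk(1)] \<open>x \<notin> N\<close> by auto
        moreover have "measure lborel k * g x - (f (Sup k) - f (Inf k)) =
            (f (Inf k) - f x - g x * (Inf k - x)) - (f (Sup k) - f x - g x * (Sup k - x))"
          "\<epsilon> * measure lborel k = \<epsilon> * (Sup k - x) + \<epsilon> * (x - Inf k)"
          unfolding ivl(6)[OF xk(1)] by (simp_all add: algebra_simps)
        ultimately show "E (x, k) \<le> \<epsilon> * measure lborel k"
          using \<open>x \<notin> N\<close> by (simp add: E_def g0_def)
      qed
      also have "\<dots> \<le> (\<Sum>i\<in>p. \<epsilon> * measure lborel (snd i))"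
        using fin \<open>\<epsilon> > 0\<close> by (intro sum_mono2) auto
      also have "\<dots> = \<epsilon> * (b - a)"
        using additive_content_tagged_division[of p a b] p ab
        by (simp add: sum_distrib_left[symmetric] case_prod_unfold)
      finally have "(\<Sum>i\<in>p. E i) < \<epsilon> * (b - a) + \<epsilon>"
        using Eq sum.subset_diff[OF \<open>q \<subseteq> p\<close> fin, of E] by simp
      also have "\<epsilon> * (b - a) + \<epsilon> \<le> (b - a + 2) * \<epsilon>"
        using \<open>\<epsilon> > 0\<close> by (simp add: algebra_simps)
      also have "\<dots> = e"
        using ab by (simp add: \<epsilon>_def)
      finally have "(\<Sum>i\<in>p. E i) < e" .
      moreover have "(\<Sum>(x,k)\<in>p. measure lborel k *\<^sub>R g0 x) - (f b - f a) =
          (\<Sum>(x,k)\<in>p. measure lborel k * g0 x - (f (Sup k) - f (Inf k)))"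
        unfolding additive_tagged_division_1[OF ab p, of f, symmetric]
        by (simp add: sum_subtractf case_prod_unfold)
      moreover have "\<bar>\<Sum>(x,k)\<in>p. measure lborel k * g0 x - (f (Sup k) - f (Inf k))\<bar> \<le> (\<Sum>i\<in>p. E i)"
        unfolding E_def case_prod_unfold by (rule sum_abs)
      ultimately show ?thesis by simp
    qed
    ultimately show "\<exists>\<gamma>. gauge \<gamma> \<and> (\<forall>\<D>. \<D> tagged_division_of {a..b} \<and> \<gamma> fine \<D> \<longrightarrow>
        norm ((\<Sum>(x,k)\<in>\<D>. measure lborel k *\<^sub>R g0 x) - (f b - f a)) < e)"
      by (intro exI[of _ \<gamma>] conjI allI impI) simp_all
  qed
  from has_integral_spike[OF neg _ this] show ?thesis by (simp add: g0_def)
qed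

section \<open>The kernel of the reflection operator\<close>

text \<open>The odd functions with \<open>kE'' = - m * kF\<close>, \<open>kF'' = - m * kE\<close>, \<open>kE' 0 = 1/2\<close> and \<open>kF' 0 = 0\<close>,
  together with their first derivatives and their antiderivatives vanishing at the origin. For
  \<open>m = 0\<close> division by zero gives the correct values \<open>kF = int_kF = 0\<close>.\<close>

definition kE :: "real \<Rightarrow> real \<Rightarrow> real" where
  "kE m x = (if m = 0 then x / 2 else (sin (sqrt \<bar>m\<bar> * x) + sinh (sqrt \<bar>m\<bar> * x)) / (4 * sqrt \<bar>m\<bar>))"

definition kE' :: "real \<Rightarrow> real \<Rightarrow> real" where
  "kE' m x = (cos (sqrt \<bar>m\<bar> * x) + cosh (sqrt \<bar>m\<bar> * x)) / 4"

definition kF :: "real \<Rightarrow> real \<Rightarrow> real" where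
  "kF m x = sgn m * (sin (sqrt \<bar>m\<bar> * x) - sinh (sqrt \<bar>m\<bar> * x)) / (4 * sqrt \<bar>m\<bar>)"

definition kF' :: "real \<Rightarrow> real \<Rightarrow> real" where
  "kF' m x = sgn m * (cos (sqrt \<bar>m\<bar> * x) - cosh (sqrt \<bar>m\<bar> * x)) / 4"

definition int_kE :: "real \<Rightarrow> real \<Rightarrow> real" where
  "int_kE m x = (if m = 0 then x\<^sup>2 / 4 else (cosh (sqrt \<bar>m\<bar> * x) - cos (sqrt \<bar>m\<bar> * x)) / (4 * \<bar>m\<bar>))"

definition int_kF :: "real \<Rightarrow> real \<Rightarrow> real" where
  "int_kF m x = sgn m * (2 - cos (sqrt \<bar>m\<bar> * x) - cosh (sqrt \<bar>m\<bar> * x)) / (4 * \<bar>m\<bar>)"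

lemma kernel_parity [simp]:
  "kE m (- x) = - kE m x" "kF m (- x) = - kF m x"
  "kE' m (- x) = kE' m x" "kF' m (- x) = kF' m x"
  "int_kE m (- x) = int_kE m x" "int_kF m (- x) = int_kF m x"
  by (simp_all add: kE_def kF_def kE'_def kF'_def int_kE_def int_kF_def right_diff_distrib
      flip: minus_divide_left)
    (simp add: add_divide_distrib diff_divide_distrib)+

lemma kernel_at_0 [simp]:
  "kE m 0 = 0" "kF m 0 = 0" "kE' m 0 = 1 / 2" "kF' m 0 = 0" "int_kE m 0 = 0" "int_kF m 0 = 0"
  by (simp_all add: kE_def kF_def kE'_def kF'_def int_kE_def int_kF_def)

text \<open>Both come from integrating the second-order relations from the origin and remain correct
  for \<open>m = 0\<close>. The constant \<open>1 / 2\<close> is \<open>kE' m 0\<close>, the source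
  of the jump of the Green's function.\<close>

lemma kE'_eq: "kE' m x = 1 / 2 - m * int_kF m x" and kF'_eq: "kF' m x = - m * int_kE m x"
  by (cases "m = 0"; simp add: kE'_def kF'_def int_kE_def int_kF_def field_simps sgn_if)+

lemma sqrt_cancel: "m \<noteq> 0 \<Longrightarrow> \<bar>m\<bar> * x / (4 * sqrt \<bar>m\<bar>) = sqrt \<bar>m\<bar> * x / 4" for m x :: real
  using real_div_sqrt[of "\<bar>m\<bar>"] by (simp add: field_simps)

section \<open>Derivatives of the unsigned kernel functions\<close>

context
  fixes g :: "real \<Rightarrow> real" and g' x m :: real and S :: "real set"
  assumes g: "(g has_real_derivative g') (at x within S)"
begin

text \<open>The rules of this block carry an inner function so that they can serve as introduction
  rules when composite expressions are differentiated.\<close>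

lemma kE_deriv: "((\<lambda>x. kE m (g x)) has_real_derivative kE' m (g x) * g') (at x within S)"
proof -
  have "(kE m has_real_derivative kE' m y) (at y)" for y
  proof (cases "m = 0")
    case True
    then have "kE m = (\<lambda>x. x / 2)" "kE' m y = 1 / 2" by (auto simp: kE_def kE'_def)
    then show ?thesis by (auto intro!: derivative_eq_intros)
  next
    case False
    then have "kE m = (\<lambda>x. (sin (sqrt \<bar>m\<bar> * x) + sinh (sqrt \<bar>m\<bar> * x)) / (4 * sqrt \<bar>m\<bar>))"
      by (auto simp: kE_def)
    then show ?thesis
      using False by (auto intro!: derivative_eq_intros simp: kE'_def field_simps)
  qed
  from DERIV_chain2[OF this g] show ?thesis .
qed

lemma kF_deriv: "((\<lambda>x. kF m (g x)) has_real_derivative kF' m (g x) * g') (at x within S)"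
proof -
  have "(kF m has_real_derivative kF' m y) (at y)" for y
    unfolding kF_def kF'_def
    by (cases "m = 0") (auto intro!: derivative_eq_intros simp: field_simps)
  from DERIV_chain2[OF this g] show ?thesis .
qed

lemma kE'_deriv: "((\<lambda>x. kE' m (g x)) has_real_derivative - m * kF m (g x) * g') (at x within S)"
proof -
  have "(kE' m has_real_derivative sqrt \<bar>m\<bar> * (sinh (sqrt \<bar>m\<bar> * y) - sin (sqrt \<bar>m\<bar> * y)) / 4) (at y)" for y
    unfolding kE'_def by (auto intro!: derivative_eq_intros simp: field_simps)
  moreover have "sqrt \<bar>m\<bar> * (sinh (sqrt \<bar>m\<bar> * y) - sin (sqrt \<bar>m\<bar> * y)) / 4 = - m * kF m y" for y
  proof (cases "m = 0")
    case False
    have "- m * kF m y = (m * sgn m) * (sinh (sqrt \<bar>m\<bar> * y) - sin (sqrt \<bar>m\<bar> * y)) / (4 * sqrt \<bar>m\<bar>)"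
      by (simp add: kF_def algebra_simps diff_divide_distrib)
    also have "m * sgn m = \<bar>m\<bar>" by (simp add: sgn_if)
    finally show ?thesis
      using sqrt_cancel[OF False, of "sinh (sqrt \<bar>m\<bar> * y) - sin (sqrt \<bar>m\<bar> * y)"] by simp
  qed (simp add: kF_def)
  ultimately have "(kE' m has_real_derivative - m * kF m y) (at y)" for y by metis
  from DERIV_chain2[OF this g] show ?thesis .
qed

lemma kF'_deriv: "((\<lambda>x. kF' m (g x)) has_real_derivative - m * kE m (g x) * g') (at x within S)"
proof -
  have "(kF' m has_real_derivative - sgn m * sqrt \<bar>m\<bar> * (sinh (sqrt \<bar>m\<bar> * y) + sin (sqrt \<bar>m\<bar> * y)) / 4) (at y)" for y
    unfolding kF'_def by (auto intro!: derivative_eq_intros simp: field_simps)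
  moreover have "- sgn m * sqrt \<bar>m\<bar> * (sinh (sqrt \<bar>m\<bar> * y) + sin (sqrt \<bar>m\<bar> * y)) / 4 = - m * kE m y" for y
  proof (cases "m = 0")
    case False
    have "m * kE m y = sgn m * (\<bar>m\<bar> * (sinh (sqrt \<bar>m\<bar> * y) + sin (sqrt \<bar>m\<bar> * y)) / (4 * sqrt \<bar>m\<bar>))"
      using False by (simp add: kE_def sgn_if add.commute)
    then show ?thesis unfolding sqrt_cancel[OF False] by simp
  qed simp
  ultimately have "(kF' m has_real_derivative - m * kE m y) (at y)" for y by metis
  from DERIV_chain2[OF this g] show ?thesis .
qed

end

lemma int_kE_deriv: "(int_kE m has_real_derivative kE m x) (at x)"
proof (cases "m = 0")
  case True
  then have "int_kE m = (\<lambda>x. x\<^sup>2 / 4)" "kE m x = x / 2" by (auto simp: int_kE_def kE_def)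
  then show ?thesis by (auto intro!: derivative_eq_intros)
next
  case False
  then have "int_kE m = (\<lambda>x. - inverse m * kF' m x)" using kF'_eq by (auto simp: field_simps)
  moreover have "((\<lambda>x. - inverse m * kF' m x) has_real_derivative kE m x) (at x)"
    using False by (auto intro!: derivative_eq_intros kF'_deriv)
  ultimately show ?thesis by simp
qed

lemma int_kF_deriv: "(int_kF m has_real_derivative kF m x) (at x)"
proof (cases "m = 0")
  case True
  then have "int_kF m = (\<lambda>x. 0)" "kF m x = 0" by (auto simp: int_kF_def kF_def)
  then show ?thesis by auto
next
  case False
  then have "int_kF m = (\<lambda>x. inverse m * (1 / 2 - kE' m x))" using kE'_eq[of m] by (auto simp: field_simps)
  moreover have "((\<lambda>x. inverse m * (1 / 2 - kE' m x)) has_real_derivative kF m x) (at x)"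
    using False by (auto intro!: derivative_eq_intros kE'_deriv)
  ultimately show ?thesis by simp
qed

text \<open>Away from the origin \<open>sgn\<close> is locally constant; at the origin it only
  changes the sign of a difference quotient that tends to zero. The condition at the origin
  separates \<open>sF\<close>, \<open>sF'\<close>, \<open>int_sE\<close> and \<open>int_sF\<close>,
  which are differentiable everywhere, from \<open>sE\<close> and \<open>sE'\<close>, where the
  value \<open>kE' m 0 = 1 / 2\<close> violates it.\<close>

lemma has_real_derivative_sgn_mult:
  assumes f: "(f has_real_derivative f') (at x)" and "x = 0 \<Longrightarrow> f 0 = 0 \<and> f' = 0"
  shows "((\<lambda>x. sgn x * f x) has_real_derivative sgn x * f') (at x)"
proof -
  consider "x > 0" | "x < 0" | "x = 0" by linarith
  then show ?thesis
  proof cases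
    case 1
    then have "\<forall>\<^sub>F y in nhds x. y > 0"
      using eventually_nhds_in_open[of "{0<..}" x] by simp
    then have "\<forall>\<^sub>F y in nhds x. sgn y * f y = f y" by eventually_elim simp
    then show ?thesis using f 1 DERIV_cong_ev[OF refl _ refl, of "\<lambda>y. sgn y * f y" f x f'] by simp
  next
    case 2
    then have "\<forall>\<^sub>F y in nhds x. y < 0"
      using eventually_nhds_in_open[of "{..<0}" x] by simp
    then have "\<forall>\<^sub>F y in nhds x. sgn y * f y = - f y" by eventually_elim simp
    then show ?thesis
      using DERIV_minus[OF f] 2 DERIV_cong_ev[OF refl _ refl, of "\<lambda>y. sgn y * f y" "\<lambda>y. - f y" x "-f'"] by simp
  next
    case 3
    then have "(\<lambda>h. f h / h) \<midarrow>0\<rightarrow> 0"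
      using f assms(2) by (simp add: DERIV_def)
    then have "(\<lambda>h. \<bar>f h / h\<bar>) \<midarrow>0\<rightarrow> 0" by (rule tendsto_rabs_zero)
    then have "(\<lambda>h. \<bar>sgn h * f h / h\<bar>) \<midarrow>0\<rightarrow> 0"
      by (rule Lim_transform_eventually) (auto simp: eventually_at_filter abs_mult abs_sgn_eq)
    then have "(\<lambda>h. sgn h * f h / h) \<midarrow>0\<rightarrow> 0" by (rule tendsto_rabs_zero_cancel)
    then show ?thesis
      using 3 assms(2) by (simp add: DERIV_def)
  qed
qed

text \<open>The sign turns the odd functions \<open>kE\<close> and \<open>kF\<close> into functions
  of \<open>\<bar>x\<bar>\<close>. As \<open>sgn 0 = 0\<close>, the value of \<open>sE'\<close> at
  the origin is zero, the midpoint of its one-sided limits and not a derivative of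
  \<open>sE\<close>.\<close>

definition sE :: "real \<Rightarrow> real \<Rightarrow> real" where "sE m x = sgn x * kE m x"
definition sE' :: "real \<Rightarrow> real \<Rightarrow> real" where "sE' m x = sgn x * kE' m x"
definition sF :: "real \<Rightarrow> real \<Rightarrow> real" where "sF m x = sgn x * kF m x"
definition sF' :: "real \<Rightarrow> real \<Rightarrow> real" where "sF' m x = sgn x * kF' m x"
definition int_sE :: "real \<Rightarrow> real \<Rightarrow> real" where "int_sE m x = sgn x * int_kE m x"
definition int_sF :: "real \<Rightarrow> real \<Rightarrow> real" where "int_sF m x = sgn x * int_kF m x"

lemmas signed_defs = sE_def sE'_def sF_def sF'_def int_sE_def int_sF_def

lemma sE_abs: "sE m x = kE m \<bar>x\<bar>"
  by (simp add: sE_def abs_real_def sgn_real_def)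

lemma signed_nonneg:
  "x \<ge> 0 \<Longrightarrow> sE m x = kE m x" "x \<ge> 0 \<Longrightarrow> sF m x = kF m x"  "x \<ge> 0 \<Longrightarrow> sF' m x = kF' m x"
  "x > 0 \<Longrightarrow> sE' m x = kE' m x"
  by (cases "x = 0"; simp add: signed_defs)+

lemma signed_parity [simp]:
  "sE m (- x) = sE m x" "sF m (- x) = sF m x"
  "sE' m (- x) = - sE' m x" "sF' m (- x) = - sF' m x"
  "int_sE m (- x) = - int_sE m x" "int_sF m (- x) = - int_sF m x"
  by (simp_all add: signed_defs sgn_minus)

text \<open>The jump of \<open>sE'\<close> is isolated in \<open>sgn x / 2\<close>, while the
  remainder is continuously differentiable; differences of such sign terms become indicators of
  intervals.\<close>

lemma sE'_eq: "sE' m x = sgn x / 2 - m * int_sF m x" and sF'_eq: "sF' m x = - m * int_sE m x"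
  by (simp_all add: signed_defs kE'_eq kF'_eq algebra_simps)

section \<open>Derivatives and continuity of the signed functions\<close>

context
  fixes g :: "real \<Rightarrow> real" and g' x m :: real and S :: "real set"
  assumes g: "(g has_real_derivative g') (at x within S)"
begin

lemma sE_deriv:
  assumes "g x \<noteq> 0"
  shows "((\<lambda>x. sE m (g x)) has_real_derivative sE' m (g x) * g') (at x within S)"
  using DERIV_chain2[OF has_real_derivative_sgn_mult[OF kE_deriv[OF DERIV_ident]] g] assms
  by (simp add: signed_defs mult.assoc)

lemma sE'_deriv:
  assumes "g x \<noteq> 0"
  shows "((\<lambda>x. sE' m (g x)) has_real_derivative - m * sF m (g x) * g') (at x within S)"
  using DERIV_chain2[OF has_real_derivative_sgn_mult[OF kE'_deriv[OF DERIV_ident]] g, of m] assms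
  by (simp add: signed_defs algebra_simps)

lemma sF_deriv: "((\<lambda>x. sF m (g x)) has_real_derivative sF' m (g x) * g') (at x within S)"
  using DERIV_chain2[OF has_real_derivative_sgn_mult[OF kF_deriv[OF DERIV_ident]] g, of m]
  by (simp add: signed_defs mult.assoc)

lemma sF'_deriv: "((\<lambda>x. sF' m (g x)) has_real_derivative - m * sE m (g x) * g') (at x within S)"
  using DERIV_chain2[OF has_real_derivative_sgn_mult[OF kF'_deriv[OF DERIV_ident]] g, of m]
  by (simp add: signed_defs algebra_simps)

lemma int_sE_deriv: "((\<lambda>x. int_sE m (g x)) has_real_derivative sE m (g x) * g') (at x within S)"
  using DERIV_chain2[OF has_real_derivative_sgn_mult[OF int_kE_deriv] g, of m]
  by (simp add: signed_defs mult.assoc)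

lemma int_sF_deriv: "((\<lambda>x. int_sF m (g x)) has_real_derivative sF m (g x) * g') (at x within S)"
  using DERIV_chain2[OF has_real_derivative_sgn_mult[OF int_kF_deriv] g, of m]
  by (simp add: signed_defs mult.assoc)

end

lemma isCont_kernel:
  "isCont (kE m) x" "isCont (kF m) x" "isCont (kE' m) x" "isCont (kF' m) x"
  "isCont (sF m) x" "isCont (sF' m) x"
  by (rule DERIV_isCont, rule kE_deriv kF_deriv kE'_deriv kF'_deriv sF_deriv sF'_deriv, rule DERIV_ident)+

lemma isCont_sE: "isCont (sE m) x"
  unfolding sE_abs[abs_def]
  by (rule isCont_o2[OF isCont_rabs[OF continuous_ident] isCont_kernel(1)])

lemma isCont_sE': "x \<noteq> 0 \<Longrightarrow> isCont (sE' m) x"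
  by (rule DERIV_isCont, rule sE'_deriv[OF DERIV_ident])

lemma continuous_on_kernel [continuous_intros]:
  assumes "continuous_on S g"
  shows "continuous_on S (\<lambda>x. kE m (g x))" "continuous_on S (\<lambda>x. kF m (g x))"
    "continuous_on S (\<lambda>x. kE' m (g x))" "continuous_on S (\<lambda>x. kF' m (g x))"
    "continuous_on S (\<lambda>x. sE m (g x))" "continuous_on S (\<lambda>x. sF m (g x))"
    "continuous_on S (\<lambda>x. sF' m (g x))"
  by (rule continuous_on_compose2[OF _ assms subset_UNIV];
      simp add: continuous_on_eq_continuous_at isCont_kernel isCont_sE)+

lemma continuous_on_sE' [continuous_intros]:
  assumes "continuous_on S g" "\<And>x. x \<in> S \<Longrightarrow> g x \<noteq> 0"
  shows "continuous_on S (\<lambda>x. sE' m (g x))"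
proof (rule continuous_on_compose2[OF _ assms(1)])
  show "continuous_on (- {0}) (sE' m)"
    by (simp add: continuous_on_eq_continuous_at open_Compl isCont_sE')
qed (use assms(2) in auto)

text \<open>For fixed \<open>s\<close> this is a fundamental solution of \<open>v''(t) + m v(-t)\<close>: the pole sits in
  \<open>sE\<close>, whose derivative jumps by one at the origin, whereas \<open>sF\<close> is twice continuously
  differentiable; the reflection exchanges the two summands.\<close>

definition kern :: "real \<Rightarrow> real \<Rightarrow> real \<Rightarrow> real" where
  "kern m t s = sE m (t - s) + sF m (t + s)"

lemma kern_commute: "kern m t s = kern m s t"
  using signed_parity(1)[of m "t - s"] by (simp add: kern_def add.commute)

text \<open>Reflecting one argument amounts to reflecting the other, which is why the kernel
  satisfies an equation of the same shape in each variable.\<close>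

lemma kern_minus: "kern m t (- s) = kern m (- t) s" "kern m (- t) (- s) = kern m t s"
proof -
  have "sE m (- t - s) = sE m (- (t + s))" "sF m (- t - s) = sF m (- (t + s))"
    "sE m (s - t) = sE m (- (t - s))" "sF m (s - t) = sF m (- (t - s))"
    by simp_all
  then show "kern m t (- s) = kern m (- t) s" "kern m (- t) (- s) = kern m t s"
    unfolding kern_def signed_parity by simp_all
qed

lemma kern_deriv_t: "t \<noteq> s \<Longrightarrow>
  ((\<lambda>t. kern m t s) has_real_derivative (sE' m (t - s) + sF' m (t + s))) (at t within S)"
  unfolding kern_def by (auto intro!: derivative_eq_intros sE_deriv sF_deriv)

lemma kern_deriv_tt: "t \<noteq> s \<Longrightarrow>
  ((\<lambda>t. sE' m (t - s) + sF' m (t + s)) has_real_derivative - m * kern m (- t) s) (at t within S)"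
  unfolding kern_minus(1)[symmetric]
  unfolding kern_def by (auto intro!: derivative_eq_intros sE'_deriv sF'_deriv simp: algebra_simps)

lemma kern_deriv_s: "t \<noteq> s \<Longrightarrow>
  ((\<lambda>s. kern m t s) has_real_derivative (- sE' m (t - s) + sF' m (t + s))) (at s within S)"
  unfolding kern_def by (auto intro!: derivative_eq_intros sE_deriv sF_deriv)

lemma kern_deriv_ss: "t \<noteq> s \<Longrightarrow>
  ((\<lambda>s. - sE' m (t - s) + sF' m (t + s)) has_real_derivative - m * kern m t (- s)) (at s within S)"
  unfolding kern_def by (auto intro!: derivative_eq_intros sE'_deriv sF'_deriv simp: algebra_simps)

lemma continuous_on_kern [continuous_intros]:
  "continuous_on S f \<Longrightarrow> continuous_on S g \<Longrightarrow> continuous_on S (\<lambda>x. kern m (f x) (g x))"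
  unfolding kern_def by (intro continuous_intros)

text \<open>On \<open>[-T, T]\<close>, \<open>homA T m s\<close> is the jump
  \<open>kern m T s - kern m (- T) s\<close> across the period; for
  \<open>\<bar>s\<bar> < T\<close>, \<open>homB T m s\<close> is the jump of the derivative in the
  first variable. Written with \<open>kE\<close> and \<open>kF\<close> in place of the signed
  functions, both are smooth solutions of the homogeneous equation with \<open>M = 0\<close> on the
  whole line.\<close>

definition homA :: "real \<Rightarrow> real \<Rightarrow> real \<Rightarrow> real" where
  "homA T m t = kE m (T - t) + kF m (T + t) - kE m (T + t) - kF m (T - t)"
definition homA' :: "real \<Rightarrow> real \<Rightarrow> real \<Rightarrow> real" where
  "homA' T m t = - kE' m (T - t) + kF' m (T + t) - kE' m (T + t) + kF' m (T - t)"
definition homB :: "real \<Rightarrow> real \<Rightarrow> real \<Rightarrow> real" where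
  "homB T m t = kE' m (T - t) + kF' m (T + t) + kE' m (T + t) + kF' m (T - t)"
definition homB' :: "real \<Rightarrow> real \<Rightarrow> real \<Rightarrow> real" where
  "homB' T m t = m * (kE m (T - t) + kF m (T - t) - kE m (T + t) - kF m (T + t))"

lemma hom_deriv:
  "(homA T m has_real_derivative homA' T m t) (at t within S)"
  "(homA' T m has_real_derivative - m * homA T m (- t)) (at t within S)"
  "(homB T m has_real_derivative homB' T m t) (at t within S)"
  "(homB' T m has_real_derivative - m * homB T m (- t)) (at t within S)"
  unfolding homA_def[abs_def] homA'_def[abs_def] homB_def[abs_def] homB'_def[abs_def]
  by (auto intro!: derivative_eq_intros kE_deriv kF_deriv kE'_deriv kF'_deriv simp: algebra_simps)

lemma continuous_on_hom [continuous_intros]: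
  "continuous_on S (homA T m)" "continuous_on S (homB T m)"
  "continuous_on S (homA' T m)" "continuous_on S (homB' T m)"
  by (rule DERIV_continuous_on, rule hom_deriv)+

lemma homA_kern: "\<bar>t\<bar> \<le> T \<Longrightarrow> homA T m t = kern m t T - kern m t (- T)"
  using signed_parity(1)[of m "T - t"] signed_parity(2)[of m "T - t"]
  by (simp add: homA_def kern_def signed_nonneg add.commute[of t T])

text \<open>Because \<open>homA\<close> is odd and \<open>homB\<close> even, \<open>homA\<close> has
  no jump in slope across the period and \<open>homB\<close> none in value.\<close>

lemma homB_eq: "homB T m (- t) = homB T m t" "homA' T m (- t) = homA' T m t"
  by (simp_all add: homB_def homA'_def)

text \<open>The integral of \<open>kern m t s\<close> over \<open>s\<close> from
  \<open>\<alpha>\<close> to \<open>\<beta>\<close>: the response of the fundamental solution to the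
  indicator of an interval, from which the response to a truncation level is built.\<close>

definition kern_ivl :: "real \<Rightarrow> real \<Rightarrow> real \<Rightarrow> real \<Rightarrow> real" where
  "kern_ivl m \<alpha> \<beta> t = int_sE m (t - \<alpha>) - int_sE m (t - \<beta>) + int_sF m (t + \<beta>) - int_sF m (t + \<alpha>)"

definition kern_ivl' :: "real \<Rightarrow> real \<Rightarrow> real \<Rightarrow> real \<Rightarrow> real" where
  "kern_ivl' m \<alpha> \<beta> t = sE m (t - \<alpha>) - sE m (t - \<beta>) + sF m (t + \<beta>) - sF m (t + \<alpha>)"

lemma has_integral_kern:
  assumes "\<alpha> \<le> \<beta>"
  shows "((\<lambda>s. kern m t s) has_integral kern_ivl m \<alpha> \<beta> t) {\<alpha>..\<beta>}"
proof -
  have "((\<lambda>s. - int_sE m (t - s) + int_sF m (t + s)) has_vector_derivative kern m t s) (at s within {\<alpha>..\<beta>})" for s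
    unfolding has_real_derivative_iff_has_vector_derivative[symmetric] kern_def
    by (auto intro!: derivative_eq_intros int_sE_deriv int_sF_deriv)
  from fundamental_theorem_of_calculus[OF assms this] show ?thesis
    by (simp add: kern_ivl_def algebra_simps)
qed

lemma kern_ivl_deriv:
  "(kern_ivl m \<alpha> \<beta> has_real_derivative kern_ivl' m \<alpha> \<beta> t) (at t within S)"
  unfolding kern_ivl_def[abs_def] kern_ivl'_def
  by (auto intro!: derivative_eq_intros int_sE_deriv int_sF_deriv)

text \<open>The sign terms split off by \<open>sE'_eq\<close> combine to the indicator of the open
  interval; by parity the remaining terms are the reflected response.\<close>

lemma kern_ivl'_deriv:
  assumes "t \<noteq> \<alpha>" "t \<noteq> \<beta>" "\<alpha> \<le> \<beta>"
  shows "(kern_ivl' m \<alpha> \<beta> has_real_derivative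
    ((if \<alpha> < t \<and> t < \<beta> then 1 else 0) - m * kern_ivl m \<alpha> \<beta> (- t))) (at t within S)"
proof -
  have J: "kern_ivl m \<alpha> \<beta> (- t) = - int_sE m (t + \<alpha>) + int_sE m (t + \<beta>) - int_sF m (t - \<beta>) + int_sF m (t - \<alpha>)"
    using signed_parity(5)[of m "t + \<alpha>"] signed_parity(5)[of m "t + \<beta>"]
      signed_parity(6)[of m "t - \<alpha>"] signed_parity(6)[of m "t - \<beta>"]
    by (simp add: kern_ivl_def)
  have "sE' m (t - \<alpha>) - sE' m (t - \<beta>) + sF' m (t + \<beta>) - sF' m (t + \<alpha>) =
      (sgn (t - \<alpha>) - sgn (t - \<beta>)) / 2 - m * kern_ivl m \<alpha> \<beta> (- t)"
    unfolding sE'_eq sF'_eq J by (simp add: algebra_simps diff_divide_distrib)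
  also have "(sgn (t - \<alpha>) - sgn (t - \<beta>)) / 2 = (if \<alpha> < t \<and> t < \<beta> then 1 else 0)"
    using assms by auto
  finally have "sE' m (t - \<alpha>) - sE' m (t - \<beta>) + sF' m (t + \<beta>) - sF' m (t + \<alpha>) =
      (if \<alpha> < t \<and> t < \<beta> then 1 else 0) - m * kern_ivl m \<alpha> \<beta> (- t)" .
  moreover have "(kern_ivl' m \<alpha> \<beta> has_real_derivative
      sE' m (t - \<alpha>) - sE' m (t - \<beta>) + sF' m (t + \<beta>) - sF' m (t + \<alpha>)) (at t within S)"
    unfolding kern_ivl'_def[abs_def] using assms(1,2)
    by (auto intro!: derivative_eq_intros sE_deriv sF_deriv)
  ultimately show ?thesis by simp
qed

lemma has_integral_homA:
  assumes "\<alpha> \<le> \<beta>" "-T \<le> \<alpha>" "\<beta> \<le> T"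
  shows "(homA T m has_integral kern_ivl m \<alpha> \<beta> T - kern_ivl m \<alpha> \<beta> (- T)) {\<alpha>..\<beta>}"
  using has_integral_diff[OF has_integral_kern[OF assms(1), of m T] has_integral_kern[OF assms(1), of m "-T"]]
  by (rule has_integral_eq[rotated]) (use assms in \<open>auto simp: homA_kern kern_commute[of m T] kern_commute[of m "- T"]\<close>)

text \<open>Since \<open>homB\<close> is the jump of the derivative of \<open>kern\<close> in
  \<open>t\<close>, this interchanges that derivative with the integral over \<open>s\<close>. An
  explicit antiderivative verifies it.\<close>

lemma has_integral_homB:
  assumes "\<alpha> \<le> \<beta>" "-T \<le> \<alpha>" "\<beta> \<le> T"
  shows "(homB T m has_integral kern_ivl' m \<alpha> \<beta> T - kern_ivl' m \<alpha> \<beta> (- T)) {\<alpha>..\<beta>}"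
proof -
  have "((\<lambda>s. - kE m (T - s) + kF m (T + s) + kE m (T + s) - kF m (T - s))
      has_vector_derivative homB T m s) (at s within {\<alpha>..\<beta>})" for s
    unfolding has_real_derivative_iff_has_vector_derivative[symmetric] homB_def
    by (auto intro!: derivative_eq_intros kE_deriv kF_deriv)
  from fundamental_theorem_of_calculus[OF assms(1) this]
  have "(homB T m has_integral (- kE m (T - \<beta>) + kF m (T + \<beta>) + kE m (T + \<beta>) - kF m (T - \<beta>)) -
      (- kE m (T - \<alpha>) + kF m (T + \<alpha>) + kE m (T + \<alpha>) - kF m (T - \<alpha>))) {\<alpha>..\<beta>}" by simp
  moreover have "sE m (- T - \<alpha>) = kE m (T + \<alpha>)" "sE m (- T - \<beta>) = kE m (T + \<beta>)"
    "sF m (- T + \<alpha>) = kF m (T - \<alpha>)" "sF m (- T + \<beta>) = kF m (T - \<beta>)"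
    using signed_parity(1)[of m "T + \<alpha>"] signed_parity(1)[of m "T + \<beta>"]
      signed_parity(2)[of m "T - \<alpha>"] signed_parity(2)[of m "T - \<beta>"] assms
    by (simp_all add: signed_nonneg)
  ultimately show ?thesis
    using assms by (simp add: kern_ivl'_def signed_nonneg algebra_simps)
qed

section \<open>Lipschitz bounds as a source of absolute continuity\<close>

lemma lipschitz_on_C1:
  fixes f :: "real \<Rightarrow> real"
  assumes "\<And>x. x \<in> {a..b} \<Longrightarrow> (f has_real_derivative f' x) (at x within {a..b})" "continuous_on {a..b} f'"
  obtains L where "L-lipschitz_on {a..b} f"
proof -
  have "bounded (f' ` {a..b})"
    using assms(2) compact_continuous_image compact_imp_bounded compact_Icc by blast
  then obtain B where B: "\<And>x. x \<in> {a..b} \<Longrightarrow> norm (f' x) \<le> \<bar>B\<bar>"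
    unfolding bounded_iff by (metis image_eqI abs_ge_self order_trans)
  have "\<bar>B\<bar>-lipschitz_on {a..b} f"
  proof (rule lipschitz_onI)
    fix x y assume "x \<in> {a..b}" "y \<in> {a..b}"
    then show "dist (f x) (f y) \<le> \<bar>B\<bar> * dist x y"
      unfolding dist_norm using assms(1) B
      by (intro field_differentiable_bound[of "{a..b}" f f']) auto
  qed simp
  then show thesis by (rule that)
qed

text \<open>The summands with \<open>sE\<close> have corners at \<open>\<alpha>\<close> and
  \<open>\<beta>\<close>. As compositions of the smooth \<open>kE\<close> with an absolute value
  they are still Lipschitz.\<close>

lemma lipschitz_kern_ivl':
  obtains L where "L-lipschitz_on {-T..T} (kern_ivl' m \<alpha> \<beta>)"
proof -
  have "\<exists>L. L-lipschitz_on {-T..T} (\<lambda>t. sE m (t - c))" for c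
  proof -
    \<comment> \<open>This interval contains \<open>\<bar>t - c\<bar>\<close> for every
      \<open>t\<close> in \<open>[-T, T]\<close>.\<close>
    obtain L where L: "L-lipschitz_on {0..T + \<bar>c\<bar>} (kE m)"
      using lipschitz_on_C1[of 0 "T + \<bar>c\<bar>" "kE m" "kE' m"] kE_deriv[OF DERIV_ident]
        continuous_on_kernel(3)[OF continuous_on_id] by auto
    have "L-lipschitz_on {-T..T} (\<lambda>t. kE m \<bar>t - c\<bar>)"
    proof (rule lipschitz_onI)
      fix x y assume xy: "x \<in> {-T..T}" "y \<in> {-T..T}"
      then have "dist (kE m \<bar>x - c\<bar>) (kE m \<bar>y - c\<bar>) \<le> L * dist \<bar>x - c\<bar> \<bar>y - c\<bar>"
        by (intro lipschitz_onD[OF L]) auto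
      also have "\<dots> \<le> L * dist x y"
        using lipschitz_on_nonneg[OF L] by (intro mult_left_mono) (auto simp: dist_real_def)
      finally show "dist (kE m \<bar>x - c\<bar>) (kE m \<bar>y - c\<bar>) \<le> L * dist x y" .
    qed (rule lipschitz_on_nonneg[OF L])
    then show ?thesis by (auto simp: sE_abs)
  qed
  moreover have "\<exists>L. L-lipschitz_on {-T..T} (\<lambda>t. sF m (t + c))" for c
  proof -
    have "((\<lambda>t. sF m (t + c)) has_real_derivative sF' m (t + c)) (at t within {-T..T})" for t
      using sF_deriv[OF DERIV_add[OF DERIV_ident DERIV_const]] by simp
    moreover have "continuous_on {-T..T} (\<lambda>t. sF' m (t + c))" by (intro continuous_intros)
    ultimately show ?thesis
      using lipschitz_on_C1[of "-T" T "\<lambda>t. sF m (t + c)" "\<lambda>t. sF' m (t + c)"] by blast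
  qed
  ultimately obtain A B C D where "A-lipschitz_on {-T..T} (\<lambda>t. sE m (t - \<alpha>))"
    "B-lipschitz_on {-T..T} (\<lambda>t. sE m (t - \<beta>))" "C-lipschitz_on {-T..T} (\<lambda>t. sF m (t + \<beta>))"
    "D-lipschitz_on {-T..T} (\<lambda>t. sF m (t + \<alpha>))" by meson
  then have "(A + B + C + D)-lipschitz_on {-T..T} (kern_ivl' m \<alpha> \<beta>)"
    unfolding kern_ivl'_def[abs_def] by (intro lipschitz_on_diff lipschitz_on_add)
  then show thesis by (rule that)
qed

section \<open>Solutions without boundary conditions\<close>

lemma trunc_minus [simp]: "trunc (- t) = - trunc t"
  by (auto simp: trunc_def ceiling_minus floor_minus)

lemma trunc_abs_le: "\<bar>real_of_int (trunc t)\<bar> \<le> \<bar>t\<bar>"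
proof (cases "t \<ge> 0")
  case True
  then show ?thesis by (simp add: trunc_def)
next
  case False
  then have "\<lceil>t\<rceil> \<le> 0" by (simp add: ceiling_le_iff)
  then have "\<bar>real_of_int \<lceil>t\<rceil>\<bar> \<le> \<bar>t\<bar>" using False le_of_int_ceiling[of t] by linarith
  then show ?thesis using False by (simp only: trunc_def if_False)
qed

lemma trunc_in_range:
  assumes "t \<in> {-T..T}"
  shows "trunc t \<in> {- trunc T..trunc T}"
proof -
  have "trunc T = \<lfloor>T\<rfloor>" using assms by (auto simp: trunc_def)
  moreover have "\<lfloor>T\<rfloor> \<ge> 0" "t \<ge> 0 \<Longrightarrow> \<lfloor>t\<rfloor> \<ge> 0" "t \<le> 0 \<Longrightarrow> \<lfloor>- t\<rfloor> \<ge> 0" using assms by auto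
  then have "trunc t \<le> \<lfloor>T\<rfloor>" "- \<lfloor>T\<rfloor> \<le> trunc t"
    using assms floor_mono[of t T] floor_mono[of "- t" T]
    by (auto simp: trunc_def ceiling_def simp del: zero_le_floor floor_minus)
  ultimately show ?thesis by auto
qed

lemma of_int_in_interval:
  assumes "n \<in> {- trunc T..trunc T}" "T > 0"
  shows "real_of_int n \<in> {-T..T}"
proof -
  have "real_of_int (trunc T) \<le> T" using trunc_abs_le[of T] assms(2) by linarith
  then show ?thesis using assms(1) unfolding atLeastAtMost_iff by linarith
qed

lemma of_int_trunc_in_interval: "t \<in> {-T..T} \<Longrightarrow> real_of_int (trunc t) \<in> {-T..T}"
  using trunc_abs_le[of t] by auto

text \<open>Truncation towards zero is constant on \<open>(-1, 1)\<close> and jumps at nonzero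
  integers only, which is why the origin is exempt.\<close>

lemma trunc_locally_constant:
  assumes "t \<in> {-T..T}" "t \<notin> D_set T - {0}"
  obtains d where "d > 0" "\<And>x. \<bar>x - t\<bar> < d \<Longrightarrow> trunc x = trunc t"
proof (cases "t = 0")
  case True
  have "trunc x = 0" if "\<bar>x\<bar> < 1" for x
    using that unfolding trunc_def by (auto simp: floor_eq_iff ceiling_eq_iff)
  then show thesis using that[of 1] True by auto
next
  case False
  then have "t \<notin> D_set T" using assms by auto
  then have "t \<noteq> of_int (trunc t)" using trunc_in_range[OF assms(1)] by (auto simp: D_set_def)
  define u where "u = \<bar>t - of_int (trunc t)\<bar>"
  have u: "0 < u" "u < 1"
    using \<open>t \<noteq> of_int (trunc t)\<close> unfolding u_def trunc_def by (auto split: if_splits) linarith+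
  \<comment> \<open>The radius exceeds neither the distances to the two neighbouring integers nor
    \<open>\<bar>t\<bar>\<close>; the latter keeps the sign fixed, so that floor and ceiling are not
    exchanged.\<close>
  define d where "d = min (min u (1 - u)) \<bar>t\<bar>"
  have "trunc x = trunc t" if "\<bar>x - t\<bar> < d" for x
  proof (cases "t > 0")
    case True
    then have "x > 0" "u = t - of_int \<lfloor>t\<rfloor>" using that by (auto simp: d_def u_def trunc_def)
    then have "\<lfloor>x\<rfloor> = \<lfloor>t\<rfloor>" using that u by (auto simp: floor_eq_iff d_def abs_if split: if_splits)
    then show ?thesis using True \<open>x > 0\<close> by (simp add: trunc_def)
  next
    case False
    then have t: "t < 0" using \<open>t \<noteq> 0\<close> by simp
    then have "x < 0" "u = of_int \<lceil>t\<rceil> - t" using that by (auto simp: d_def u_def trunc_def)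
    then have "\<lceil>x\<rceil> = \<lceil>t\<rceil>" using that u by (auto simp: ceiling_eq_iff d_def abs_if split: if_splits)
    then show ?thesis using t \<open>x < 0\<close> by (simp add: trunc_def)
  qed
  moreover have "d > 0" using u False by (simp add: d_def)
  ultimately show thesis using that by blast
qed

lemma continuous_within_trunc:
  assumes "t \<in> {-T..T}" "t \<notin> D_set T - {0}"
  shows "continuous (at t within S) (\<lambda>s. f (trunc s) :: real)"
proof -
  obtain d where "d > 0" "\<And>x. \<bar>x - t\<bar> < d \<Longrightarrow> trunc x = trunc t"
    using trunc_locally_constant[OF assms] by blast
  then have "\<forall>\<^sub>F x in at t within S. f (trunc t) = f (trunc x)"
    unfolding eventually_at dist_real_def by metis
  then show ?thesis unfolding continuous_within
    by (rule Lim_transform_eventually[OF tendsto_const])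
qed

text \<open>With these indicators the term \<open>M v([t])\<close> becomes a finite linear
  combination whose coefficients are values of \<open>v\<close> at integers.\<close>

definition level :: "int \<Rightarrow> real \<Rightarrow> real" where
  "level n t = (if trunc t = n then 1 else 0)"

lemma trunc_sum_level:
  fixes f :: "int \<Rightarrow> real"
  assumes "t \<in> {-T..T}"
  shows "f (trunc t) = (\<Sum>n\<in>{- trunc T..trunc T}. f n * level n t)"
  using trunc_in_range[OF assms] by (simp add: level_def if_distrib sum.delta cong: if_cong)

text \<open>Each level set is an interval, cut off here at \<open>T\<close> and \<open>-T\<close>.
  Leaving its endpoints undecided is harmless for integrals and for equations that hold almost
  everywhere. The last clause records that for integer \<open>T\<close> the extreme levels shrink to
  single points.\<close>

lemma level_interval:
  assumes "T > 0" "n \<in> {- trunc T..trunc T}"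
  obtains \<alpha> \<beta> where "\<alpha> \<le> \<beta>" "-T \<le> \<alpha>" "\<beta> \<le> T"
    "\<And>t. t \<in> {-T..T} \<Longrightarrow> t \<noteq> \<alpha> \<Longrightarrow> t \<noteq> \<beta> \<Longrightarrow> level n t = (if \<alpha> < t \<and> t < \<beta> then 1 else 0)"
    "\<bar>of_int n\<bar> = T \<Longrightarrow> \<alpha> = \<beta>"
proof -
  have nT: "\<bar>real_of_int n\<bar> \<le> T" using of_int_in_interval[OF assms(2,1)] by auto
  consider "n > 0" | "n = 0" | "n < 0" by linarith
  then show thesis
  proof cases
    case 1
    show thesis
    proof (rule that[of "of_int n" "min (of_int n + 1) T"])
      fix t assume t: "t \<in> {-T..T}" "t \<noteq> of_int n" "t \<noteq> min (of_int n + 1) T"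
      have "trunc t = n \<longleftrightarrow> of_int n \<le> t \<and> t < of_int n + 1"
        using 1 by (auto simp: trunc_def floor_eq_iff ceiling_eq_iff; linarith)
      then show "level n t = (if of_int n < t \<and> t < min (of_int n + 1) T then 1 else 0)"
        using t by (auto simp: level_def)
    qed (use 1 nT in auto)
  next
    case 2
    show thesis
    proof (rule that[of "- min 1 T" "min 1 T"])
      fix t assume t: "t \<in> {-T..T}" "t \<noteq> - min 1 T" "t \<noteq> min 1 T"
      have "trunc t = n \<longleftrightarrow> - 1 < t \<and> t < 1"
        using 2 by (auto simp: trunc_def floor_eq_iff ceiling_eq_iff; linarith)
      then show "level n t = (if - min 1 T < t \<and> t < min 1 T then 1 else 0)"
        using t by (auto simp: level_def min_def split: if_splits)
    qed (use 2 assms(1) nT in auto)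
  next
    case 3
    show thesis
    proof (rule that[of "max (of_int n - 1) (- T)" "of_int n"])
      fix t assume t: "t \<in> {-T..T}" "t \<noteq> max (of_int n - 1) (- T)" "t \<noteq> of_int n"
      have "trunc t = n \<longleftrightarrow> of_int n - 1 < t \<and> t \<le> of_int n"
        using 3 by (auto simp: trunc_def floor_eq_iff ceiling_eq_iff; linarith)
      then show "level n t = (if max (of_int n - 1) (- T) < t \<and> t < of_int n then 1 else 0)"
        using t by (auto simp: level_def)
    qed (use 3 nT in auto)
  qed
qed

lemma has_integral_mult_level:
  assumes "T > 0" "n \<in> {- trunc T..trunc T}"
  obtains \<alpha> \<beta> where "\<alpha> \<le> \<beta>" "-T \<le> \<alpha>" "\<beta> \<le> T"
    "\<And>t. t \<in> {-T..T} \<Longrightarrow> t \<noteq> \<alpha> \<Longrightarrow> t \<noteq> \<beta> \<Longrightarrow> level n t = (if \<alpha> < t \<and> t < \<beta> then 1 else 0)"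
    "\<And>f i. (f has_integral i) {\<alpha>..\<beta>} \<Longrightarrow> ((\<lambda>s. f s * level n s) has_integral (i :: real)) {-T..T}"
proof -
  obtain \<alpha> \<beta> where ab: "\<alpha> \<le> \<beta>" "-T \<le> \<alpha>" "\<beta> \<le> T"
    and lv: "\<And>t. t \<in> {-T..T} \<Longrightarrow> t \<noteq> \<alpha> \<Longrightarrow> t \<noteq> \<beta> \<Longrightarrow> level n t = (if \<alpha> < t \<and> t < \<beta> then 1 else 0)"
    by (rule level_interval[OF assms]) blast
  show thesis
  proof (rule that[OF ab lv])
    fix f :: "real \<Rightarrow> real" and i assume "(f has_integral i) {\<alpha>..\<beta>}"
    then have "((\<lambda>s. if s \<in> {\<alpha>..\<beta>} then f s else 0) has_integral i) {-T..T}"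
      using ab by (subst has_integral_restrict) auto
    then show "((\<lambda>s. f s * level n s) has_integral i) {-T..T}"
      by (rule has_integral_spike_finite[of "{\<alpha>, \<beta>}", rotated 2]) (auto simp: lv)
  qed
qed

lemma level_absolutely_integrable:
  assumes "T > 0" "n \<in> {- trunc T..trunc T}"
  shows "level n absolutely_integrable_on {-T..T}"
proof -
  obtain \<alpha> \<beta> where "\<And>f i. (f has_integral i) {\<alpha>..\<beta>} \<Longrightarrow> ((\<lambda>s. f s * level n s) has_integral (i :: real)) {-T..T}"
    by (rule has_integral_mult_level[OF assms]) blast
  from this[OF has_integral_const_real[of 1]] have "level n integrable_on {-T..T}" by auto
  then show ?thesis by (intro nonnegative_absolutely_integrable_1) (auto simp: level_def)
qed

lemma trunc_absolutely_integrable: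
  assumes "T > 0"
  shows "(\<lambda>t. f (trunc t) :: real) absolutely_integrable_on {-T..T}"
proof -
  have "(\<lambda>t. \<Sum>n\<in>{- trunc T..trunc T}. f n * level n t) absolutely_integrable_on {-T..T}"
    using level_absolutely_integrable[OF assms]
    by (intro absolutely_integrable_sum) (auto intro: set_integrable_mult_right)
  then show ?thesis
    using trunc_sum_level[of _ T f] absolutely_integrable_spike[of _ _ "{}"] by (metis (lifting) DiffD1 negligible_empty)
qed

text \<open>The notion of solution without boundary conditions. The derivative is a parameter
  because linear combinations and boundary terms refer to a fixed \<open>v'\<close>.\<close>

definition solves :: "real \<Rightarrow> real \<Rightarrow> real \<Rightarrow> (real \<Rightarrow> real) \<Rightarrow> (real \<Rightarrow> real) \<Rightarrow> (real \<Rightarrow> real) \<Rightarrow> bool" where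
  "solves T m M \<sigma> v v' \<longleftrightarrow>
    (\<forall>t\<in>{-T..T}. (v has_real_derivative v' t) (at t within {-T..T})) \<and>
    abs_continuous_on_ivl (-T) T v' \<and>
    (AE t\<in>{-T..T} in lebesgue. \<exists>d. (v' has_real_derivative d) (at t within {-T..T}) \<and>
       d + m * v (- t) + M * v (of_int (trunc t)) = \<sigma> t)"

lemma is_solution_iff_solves:
  "is_solution T m M \<sigma> v \<longleftrightarrow> (\<exists>v'. solves T m M \<sigma> v v' \<and> v T = v (-T) \<and> v' T = v' (-T))"
  unfolding is_solution_def solves_def by (intro iff_exI) (simp only: conj_assoc eq_commute[of "_ (- T)" "_ T"])

section \<open>Linearity and symmetry of the equation\<close>

lemma has_real_derivative_cong_on:
  fixes f :: "real \<Rightarrow> real"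
  assumes "(f has_real_derivative d) (at t within S)" "t \<in> S" "\<And>x. x \<in> S \<Longrightarrow> f x = g x"
  shows "(g has_real_derivative d) (at t within S)"
  using assms by (intro has_field_derivative_transform_within[OF assms(1), of 1]) auto

lemma is_solution_cong:
  assumes "T > 0" "\<And>t. t \<in> {-T..T} \<Longrightarrow> v t = w t" "is_solution T m M \<sigma> v"
  shows "is_solution T m M \<sigma> w"
proof -
  obtain v' where v': "solves T m M \<sigma> v v'" "v T = v (-T)" "v' T = v' (-T)"
    using assms(3) unfolding is_solution_iff_solves by blast
  have "solves T m M \<sigma> w v'"
    unfolding solves_def
  proof (intro conjI ballI)
    fix t assume t: "t \<in> {-T..T}"
    then have "(v has_real_derivative v' t) (at t within {-T..T})" using v' by (simp add: solves_def)
    then show "(w has_real_derivative v' t) (at t within {-T..T})"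
      using t assms(2) by (rule has_real_derivative_cong_on)
  next
    show "abs_continuous_on_ivl (-T) T v'" using v' by (simp add: solves_def)
    have "AE t\<in>{-T..T} in lebesgue. \<exists>d. (v' has_real_derivative d) (at t within {-T..T}) \<and>
       d + m * v (- t) + M * v (of_int (trunc t)) = \<sigma> t" using v' by (simp add: solves_def)
    then show "AE t\<in>{-T..T} in lebesgue. \<exists>d. (v' has_real_derivative d) (at t within {-T..T}) \<and>
       d + m * w (- t) + M * w (of_int (trunc t)) = \<sigma> t"
    proof eventually_elim
      case (elim t)
      show ?case
      proof
        assume t: "t \<in> {-T..T}"
        then have "w (- t) = v (- t)" "w (of_int (trunc t)) = v (of_int (trunc t))"
          using of_int_trunc_in_interval[OF t] assms(2) by auto
        then show "\<exists>d. (v' has_real_derivative d) (at t within {-T..T}) \<and>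
          d + m * w (- t) + M * w (of_int (trunc t)) = \<sigma> t" using elim t by auto
      qed
    qed
  qed
  then show ?thesis
    unfolding is_solution_iff_solves using v' assms by (intro exI[of _ v']) auto
qed

lemma solves_lincomb:
  assumes v: "solves T m M \<sigma> v v'" and w: "solves T m M \<tau> w w'"
  shows "solves T m M (\<lambda>t. c * \<sigma> t + d * \<tau> t) (\<lambda>t. c * v t + d * w t) (\<lambda>t. c * v' t + d * w' t)"
  unfolding solves_def
proof (intro conjI ballI)
  fix t assume "t \<in> {-T..T}"
  then show "((\<lambda>t. c * v t + d * w t) has_real_derivative c * v' t + d * w' t) (at t within {-T..T})"
    using v w unfolding solves_def by (intro DERIV_add DERIV_cmult) auto
next
  show "abs_continuous_on_ivl (-T) T (\<lambda>t. c * v' t + d * w' t)"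
    using v w unfolding solves_def by (intro abs_continuous_lincomb) auto
next
  have "AE t\<in>{-T..T} in lebesgue. \<exists>d. (v' has_real_derivative d) (at t within {-T..T}) \<and>
       d + m * v (- t) + M * v (of_int (trunc t)) = \<sigma> t"
    "AE t\<in>{-T..T} in lebesgue. \<exists>d. (w' has_real_derivative d) (at t within {-T..T}) \<and>
       d + m * w (- t) + M * w (of_int (trunc t)) = \<tau> t" using v w by (simp_all add: solves_def)
  then show "AE t\<in>{-T..T} in lebesgue. \<exists>D. ((\<lambda>t. c * v' t + d * w' t) has_real_derivative D) (at t within {-T..T}) \<and>
       D + m * (c * v (- t) + d * w (- t)) + M * (c * v (of_int (trunc t)) + d * w (of_int (trunc t))) = c * \<sigma> t + d * \<tau> t"
  proof eventually_elim
    case (elim t)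
    show ?case
    proof
      assume "t \<in> {-T..T}"
      then obtain p q where p: "(v' has_real_derivative p) (at t within {-T..T})"
          "p + m * v (- t) + M * v (of_int (trunc t)) = \<sigma> t"
        and q: "(w' has_real_derivative q) (at t within {-T..T})"
          "q + m * w (- t) + M * w (of_int (trunc t)) = \<tau> t" using elim by blast
      have "((\<lambda>t. c * v' t + d * w' t) has_real_derivative c * p + d * q) (at t within {-T..T})"
        using p q by (intro DERIV_add DERIV_cmult) auto
      then show "\<exists>D. ((\<lambda>t. c * v' t + d * w' t) has_real_derivative D) (at t within {-T..T}) \<and>
       D + m * (c * v (- t) + d * w (- t)) + M * (c * v (of_int (trunc t)) + d * w (of_int (trunc t))) = c * \<sigma> t + d * \<tau> t"
        by (intro exI[of _ "c * p + d * q"] conjI) (auto simp: p(2)[symmetric] q(2)[symmetric] algebra_simps)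
    qed
  qed
qed

lemma solves_piecewise:
  assumes v: "\<And>t. t \<in> {-T..T} \<Longrightarrow> (v has_real_derivative v' t) (at t within {-T..T})"
    and L: "L-lipschitz_on {-T..T} v'" and X: "finite X"
    and eq: "\<And>t. t \<in> {-T..T} - X \<Longrightarrow> (v' has_real_derivative \<sigma> t - m * v (- t) - M * v (of_int (trunc t))) (at t within {-T..T})"
  shows "solves T m M \<sigma> v v'"
  unfolding solves_def
proof (intro conjI ballI)
  show "abs_continuous_on_ivl (-T) T v'" using L by (rule abs_continuous_lipschitz)
  have "X \<in> null_sets lebesgue" using X negligible_finite negligible_iff_null_sets by blast
  then have "AE t in lebesgue. t \<notin> X" by (rule AE_not_in)
  then show "AE t\<in>{-T..T} in lebesgue. \<exists>d. (v' has_real_derivative d) (at t within {-T..T}) \<and>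
       d + m * v (- t) + M * v (of_int (trunc t)) = \<sigma> t"
  proof eventually_elim
    case (elim t)
    then show ?case using eq[of t] by (auto intro!: exI[of _ "\<sigma> t - m * v (- t) - M * v (of_int (trunc t))"])
  qed
qed (rule v)

lemma solves_0: "solves T m M (\<lambda>_. 0) (\<lambda>_. 0) (\<lambda>_. 0)"
  by (rule solves_piecewise[of T _ _ 0 "{}"]) (auto intro: lipschitz_on_constant)

text \<open>Every such function solves the equation with the right-hand side that it produces
  itself. This generates functions with prescribed boundary jumps.\<close>

lemma solves_C2:
  assumes "\<And>t. (v has_real_derivative v' t) (at t within {-T..T})"
    and "\<And>t. (v' has_real_derivative v'' t) (at t within {-T..T})" and "continuous_on {-T..T} v''"
  shows "solves T m M (\<lambda>t. v'' t + m * v (- t) + M * v (of_int (trunc t))) v v'"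
proof -
  obtain L where "L-lipschitz_on {-T..T} v'" using lipschitz_on_C1[of "-T" T v' v''] assms(2,3) by auto
  then show ?thesis using assms by (intro solves_piecewise[of T _ _ L "{}"]) auto
qed

lemma solves_sum:
  assumes "finite A" "\<And>n. n \<in> A \<Longrightarrow> solves T m M (\<sigma> n) (v n) (v' n)"
  shows "solves T m M (\<lambda>t. \<Sum>n\<in>A. c n * \<sigma> n t) (\<lambda>t. \<Sum>n\<in>A. c n * v n t) (\<lambda>t. \<Sum>n\<in>A. c n * v' n t)"
  using assms
proof (induction A rule: finite_induct)
  case empty
  then show ?case using solves_0 by simp
next
  case (insert a A)
  then show ?case
    using solves_lincomb[of T m M "\<sigma> a" "v a" "v' a" _ _ _ "c a" 1] by simp
qed

lemma solves_add_trunc_term: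
  assumes "solves T m 0 \<sigma> v v'"
  shows "solves T m M (\<lambda>t. \<sigma> t + M * v (of_int (trunc t))) v v'"
  using assms unfolding solves_def by simp

lemma solves_rhs_cong:
  assumes "solves T m M \<sigma> v v'" "\<And>t. t \<in> {-T..T} \<Longrightarrow> \<sigma> t = \<tau> t"
  shows "solves T m M \<tau> v v'"
  using assms unfolding solves_def by (auto elim!: AE_mp)

text \<open>The equation commutes with \<open>t \<mapsto> - t\<close> because truncation is odd; the
  symmetry of the Green's function originates here.\<close>

lemma solves_reflect:
  assumes "solves T m M \<sigma> v v'"
  shows "solves T m M (\<lambda>t. \<sigma> (- t)) (\<lambda>t. v (- t)) (\<lambda>t. - v' (- t))"
  unfolding solves_def
proof (intro conjI ballI)
  have refl: "((\<lambda>t. f (- t)) has_real_derivative - d) (at t within {-T..T})"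
    if "(f has_real_derivative d) (at (- t) within {-T..T})" for f d t
  proof -
    have "uminus ` {-T..T} = {-T..T}" by simp
    moreover have "(uminus has_real_derivative - 1) (at t within {-T..T})"
      by (rule DERIV_minus[OF DERIV_ident])
    ultimately show ?thesis
      using DERIV_image_chain[of f d uminus t "{-T..T}" "-1"] that by (simp add: o_def)
  qed
  show "((\<lambda>t. v (- t)) has_real_derivative - v' (- t)) (at t within {-T..T})" if "t \<in> {-T..T}" for t
    using assms that by (intro refl) (auto simp: solves_def)
  have "abs_continuous_on_ivl (-T) T (\<lambda>t. v' (- t))"
    using abs_continuous_reflect[of "-T" T v'] assms by (simp add: solves_def)
  from abs_continuous_lincomb[OF this this, of "-1" 0]
  show "abs_continuous_on_ivl (-T) T (\<lambda>t. - v' (- t))" by simp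
  obtain N where N: "negligible N"
    and eq: "\<And>t. t \<in> {-T..T} \<Longrightarrow> t \<notin> N \<Longrightarrow> \<exists>d. (v' has_real_derivative d) (at t within {-T..T}) \<and>
       d + m * v (- t) + M * v (of_int (trunc t)) = \<sigma> t"
  proof -
    have "AE t\<in>{-T..T} in lebesgue. \<exists>d. (v' has_real_derivative d) (at t within {-T..T}) \<and>
       d + m * v (- t) + M * v (of_int (trunc t)) = \<sigma> t" using assms by (simp add: solves_def)
    then obtain N where "{t \<in> space lebesgue. \<not> (t \<in> {-T..T} \<longrightarrow> (\<exists>d. (v' has_real_derivative d) (at t within {-T..T}) \<and>
       d + m * v (- t) + M * v (of_int (trunc t)) = \<sigma> t))} \<subseteq> N"
      "emeasure lebesgue N = 0" "N \<in> sets lebesgue" by (rule AE_E)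
    then show thesis by (intro that[of N]) (auto simp: negligible_iff_null_sets)
  qed
  \<comment> \<open>The exceptional set is reflected as well, and a differentiable image of a null
    set is null.\<close>
  have "negligible (uminus ` N)"
    using N by (intro negligible_differentiable_image_negligible)
      (auto intro!: derivative_intros simp: differentiable_on_def)
  then have "uminus ` N \<in> null_sets lebesgue" by (simp add: negligible_iff_null_sets)
  then have "AE t in lebesgue. t \<notin> uminus ` N" by (rule AE_not_in)
  then show "AE t\<in>{-T..T} in lebesgue. \<exists>d. ((\<lambda>t. - v' (- t)) has_real_derivative d) (at t within {-T..T}) \<and>
       d + m * v (- (- t)) + M * v (- of_int (trunc t)) = \<sigma> (- t)"
  proof eventually_elim
    case (elim t)
    show ?case
    proof
      assume "t \<in> {-T..T}"
      moreover have "- t \<notin> N" using elim by (metis image_eqI minus_minus)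
      ultimately obtain d where d: "(v' has_real_derivative d) (at (- t) within {-T..T})"
        "d + m * v (- (- t)) + M * v (of_int (trunc (- t))) = \<sigma> (- t)" using eq[of "- t"] by auto
      have "((\<lambda>t. - v' (- t)) has_real_derivative d) (at t within {-T..T})"
        using DERIV_minus[OF refl[OF d(1)]] by simp
      then show "\<exists>d. ((\<lambda>t. - v' (- t)) has_real_derivative d) (at t within {-T..T}) \<and>
       d + m * v (- (- t)) + M * v (- of_int (trunc t)) = \<sigma> (- t)" using d(2) by auto
    qed
  qed
qed

section \<open>Integrated form of the equation and Green's identity\<close>

lemma solves_continuous:
  assumes "solves T m M \<sigma> v v'"
  shows "continuous_on {-T..T} v" "continuous_on {-T..T} v'"
  using assms abs_continuous_imp_continuous_on unfolding solves_def
  by (auto intro: DERIV_continuous_on)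

lemma solves_imp_AE_deriv:
  assumes "solves T m M \<sigma> v v'" "-T \<le> a" "b \<le> T"
  shows "AE t\<in>{a..b} in lebesgue. (v' has_real_derivative \<sigma> t - m * v (- t) - M * v (of_int (trunc t))) (at t within {a..b})"
proof -
  have "AE t\<in>{-T..T} in lebesgue. \<exists>d. (v' has_real_derivative d) (at t within {-T..T}) \<and>
       d + m * v (- t) + M * v (of_int (trunc t)) = \<sigma> t" using assms by (simp add: solves_def)
  then show ?thesis
  proof eventually_elim
    case (elim t)
    show ?case
    proof
      assume t: "t \<in> {a..b}"
      then obtain d where d: "(v' has_real_derivative d) (at t within {-T..T})"
        "d + m * v (- t) + M * v (of_int (trunc t)) = \<sigma> t" using elim assms by auto
      moreover have "d = \<sigma> t - m * v (- t) - M * v (of_int (trunc t))" using d(2) by simp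
      ultimately show "(v' has_real_derivative \<sigma> t - m * v (- t) - M * v (of_int (trunc t))) (at t within {a..b})"
        using DERIV_subset[OF d(1)] assms by auto
    qed
  qed
qed

lemma solves_has_integral:
  assumes "solves T m M \<sigma> v v'" "-T \<le> a" "a \<le> b" "b \<le> T"
  shows "((\<lambda>s. \<sigma> s - m * v (- s) - M * v (of_int (trunc s))) has_integral (v' b - v' a)) {a..b}"
  using abs_continuous_subinterval[of "-T" T v' a b] solves_imp_AE_deriv[OF assms(1,2,4)] assms
  by (intro fundamental_theorem_abs_continuous) (auto simp: solves_def)

text \<open>The equation is known almost everywhere only. Its integrated form writes
  \<open>v'\<close> as an indefinite integral, which is differentiable wherever the integrand is
  continuous; so the equation holds at each such point.\<close>

lemma solves_second_derivative:
  assumes "solves T m M \<sigma> v v'" "t \<in> {-T..T}" "t \<notin> D_set T - {0}"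
    and \<sigma>: "continuous (at t within {-T..T}) \<sigma>"
  shows "(v' has_real_derivative \<sigma> t - m * v (- t) - M * v (of_int (trunc t))) (at t within {-T..T})"
proof -
  define f where "f s = \<sigma> s - m * v (- s) - M * v (of_int (trunc s))" for s
  have "continuous_on {-T..T} (\<lambda>s. v (- s))"
    by (rule continuous_on_compose2[OF solves_continuous(1)[OF assms(1)]]) (auto intro!: continuous_intros)
  then have "continuous (at t within {-T..T}) (\<lambda>s. v (- s))"
    using assms(2) by (simp add: continuous_on_eq_continuous_within)
  then have "continuous (at t within {-T..T}) f"
    unfolding f_def using \<sigma> continuous_within_trunc[OF assms(2,3), of "{-T..T}" "\<lambda>n. v (of_int n)"]
    by (intro continuous_intros) auto
  moreover have "f integrable_on {-T..T}"
    using solves_has_integral[OF assms(1), of "-T" T] assms(2) unfolding f_def by auto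
  ultimately have "((\<lambda>u. integral {-T..u} f) has_real_derivative f t) (at t within {-T..T})"
    using integral_has_vector_derivative_continuous_at[of f "-T" T t "{}"] assms(2)
    by (simp add: has_real_derivative_iff_has_vector_derivative)
  then have "((\<lambda>u. v' (-T) + integral {-T..u} f) has_real_derivative f t) (at t within {-T..T})"
    by (auto intro!: derivative_eq_intros)
  moreover have "v' (-T) + integral {-T..u} f = v' u" if "u \<in> {-T..T}" for u
    using solves_has_integral[OF assms(1), of "-T" u] that unfolding f_def
    by (auto dest!: integral_unique)
  ultimately show ?thesis
    using has_real_derivative_cong_on[OF _ assms(2)] unfolding f_def by force
qed

text \<open>The integrand is \<open>k v'' - k'' v\<close>, the derivative of
  \<open>k v' - k' v\<close>, with \<open>v''\<close> replaced by means of the equation. That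
  function is absolutely continuous, since \<open>k\<close>, \<open>k'\<close> and \<open>v\<close>
  are C^1 and hence Lipschitz.\<close>

lemma green_identity:
  assumes sol: "solves T m M \<sigma> v v'" and ab: "-T \<le> a" "a \<le> b" "b \<le> T"
    and k: "\<And>s. s \<in> {a..b} \<Longrightarrow> (k has_real_derivative k' s) (at s within {a..b})"
      "\<And>s. s \<in> {a..b} \<Longrightarrow> (k' has_real_derivative k'' s) (at s within {a..b})"
      "continuous_on {a..b} k''"
  shows "((\<lambda>s. k s * (\<sigma> s - m * v (- s) - M * v (of_int (trunc s))) - k'' s * v s) has_integral
     ((k b * v' b - k' b * v b) - (k a * v' a - k' a * v a))) {a..b}"
proof (rule fundamental_theorem_abs_continuous[OF _ ab(2)])
  have v: "(v has_real_derivative v' s) (at s within {a..b})" if "s \<in> {a..b}" for s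
    using sol ab that by (auto simp: solves_def intro: DERIV_subset[of _ _ _ "{-T..T}"])
  have cont: "continuous_on {a..b} k'" "continuous_on {a..b} v'"
    using k(2) DERIV_continuous_on solves_continuous(2)[OF sol] ab
    by (blast, auto intro: continuous_on_subset)
  obtain A B C where "A-lipschitz_on {a..b} k" "B-lipschitz_on {a..b} k'" "C-lipschitz_on {a..b} v"
    using lipschitz_on_C1[OF k(1) cont(1)] lipschitz_on_C1[OF k(2,3)] lipschitz_on_C1[OF v cont(2)] by metis
  moreover have "abs_continuous_on_ivl a b v'"
    using sol ab abs_continuous_subinterval[of "-T" T v' a b] by (simp add: solves_def)
  ultimately have "abs_continuous_on_ivl a b (\<lambda>s. k s * v' s)" "abs_continuous_on_ivl a b (\<lambda>s. k' s * v s)"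
    by (blast intro: abs_continuous_mult abs_continuous_lipschitz)+
  from abs_continuous_lincomb[OF this, of 1 "-1"]
  show "abs_continuous_on_ivl a b (\<lambda>s. k s * v' s - k' s * v s)" by simp
  from solves_imp_AE_deriv[OF sol ab(1,3)]
  show "AE s\<in>{a..b} in lebesgue. ((\<lambda>s. k s * v' s - k' s * v s) has_real_derivative
     k s * (\<sigma> s - m * v (- s) - M * v (of_int (trunc s))) - k'' s * v s) (at s within {a..b})"
  proof eventually_elim
    case (elim s)
    show ?case
    proof
      assume s: "s \<in> {a..b}"
      show "((\<lambda>s. k s * v' s - k' s * v s) has_real_derivative
        k s * (\<sigma> s - m * v (- s) - M * v (of_int (trunc s))) - k'' s * v s) (at s within {a..b})"
        using DERIV_diff[OF DERIV_mult[OF k(1)[OF s] mp[OF elim s]] DERIV_mult[OF k(2)[OF s] v[OF s]]]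
        by (simp add: algebra_simps)
    qed
  qed
qed

text \<open>The difference of two solutions solves the homogeneous periodic problem, so uniqueness
  is invoked for the right-hand side zero and \<open>\<sigma>\<close> may be arbitrary.\<close>

lemma uniquely_solvable_unique:
  assumes "uniquely_solvable T m M"
    and v: "solves T m M \<sigma> v v'" "v T = v (-T)" "v' T = v' (-T)"
    and w: "solves T m M \<sigma> w w'" "w T = w (-T)" "w' T = w' (-T)"
    and t: "t \<in> {-T..T}"
  shows "v t = w t"
proof -
  have "(\<lambda>_. 0 :: real) absolutely_integrable_on {-T..T}" by simp
  then obtain u where u: "\<And>w. is_solution T m M (\<lambda>_. 0) w \<Longrightarrow> \<forall>t\<in>{-T..T}. w t = u t"
    using assms(1) unfolding uniquely_solvable_def by blast
  have "is_solution T m M (\<lambda>_. 0) (\<lambda>_. 0)"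
    unfolding is_solution_iff_solves using solves_0 by (intro exI[of _ "\<lambda>_. 0"]) simp
  moreover have "is_solution T m M (\<lambda>_. 0) (\<lambda>t. v t - w t)"
    unfolding is_solution_iff_solves using solves_lincomb[OF v(1) w(1), of 1 "-1"] v w
    by (intro exI[of _ "\<lambda>t. v' t - w' t"]) simp
  ultimately have "\<forall>t\<in>{-T..T}. (0::real) = u t" "\<forall>t\<in>{-T..T}. v t - w t = u t" by (auto dest: u)
  then show ?thesis using t by force
qed

lemma uniquely_solvable_exists:
  assumes "uniquely_solvable T m M" "\<sigma> absolutely_integrable_on {-T..T}"
  obtains v v' where "solves T m M \<sigma> v v'" "v T = v (-T)" "v' T = v' (-T)"
  using assms unfolding uniquely_solvable_def is_solution_iff_solves by blast

text \<open>Subtracting from \<open>y\<close> the periodic solution with the same right-hand side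
  removes that right-hand side and leaves the jumps of \<open>y\<close> intact.\<close>

lemma exists_homogeneous_with_jump:
  assumes "T > 0" "uniquely_solvable T m M"
    and y: "\<And>t S. (y has_real_derivative y' t) (at t within S)" "\<And>t S. (y' has_real_derivative y'' t) (at t within S)"
      "continuous_on {-T..T} y''"
  obtains w w' where "solves T m M (\<lambda>_. 0) w w'" "w T - w (-T) = y T - y (-T)" "w' T - w' (-T) = y' T - y' (-T)"
proof -
  define \<sigma> where "\<sigma> t = y'' t + m * y (- t) + M * y (of_int (trunc t))" for t
  have "solves T m M \<sigma> y y'" unfolding \<sigma>_def using y by (intro solves_C2) auto
  have "continuous_on UNIV y" using y(1) by (rule DERIV_continuous_on)
  then have "continuous_on {-T..T} (\<lambda>t. y'' t + m * y (- t))"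
    using y(3) by (auto intro!: continuous_intros continuous_on_compose2[of UNIV y])
  from set_integral_add(1)[OF absolutely_integrable_continuous_real[OF this]
      trunc_absolutely_integrable[OF assms(1), of "\<lambda>n. M * y (of_int n)"]]
  have "\<sigma> absolutely_integrable_on {-T..T}" unfolding \<sigma>_def .
  then obtain q q' where q: "solves T m M \<sigma> q q'" "q T = q (-T)" "q' T = q' (-T)"
    using uniquely_solvable_exists[OF assms(2)] by blast
  show thesis
    using solves_lincomb[OF \<open>solves T m M \<sigma> y y'\<close> q(1), of 1 "-1"] q(2,3)
    by (intro that[of "\<lambda>t. y t - q t" "\<lambda>t. y' t - q' t"]) auto
qed

section \<open>The corrected kernel\<close>

text \<open>Under the integral, \<open>s \<mapsto> - s\<close> exchanges \<open>m k(s) v(-s)\<close>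
  and \<open>m k(-s) v(s)\<close>, so the reflection terms cancel. What still separates Green's
  identity from the integral of \<open>k \<sigma>\<close> is the term \<open>M v([s])\<close>,
  resolved into levels.\<close>

lemma integral_against_rhs:
  assumes T: "T > 0" and sol: "solves T m M \<sigma> v v'" and k: "continuous_on {-T..T} k"
    and i: "((\<lambda>s. k s * (\<sigma> s - m * v (- s) - M * v (of_int (trunc s))) + m * k (- s) * v s) has_integral i) {-T..T}"
    and j: "\<And>n. n \<in> {- trunc T..trunc T} \<Longrightarrow> ((\<lambda>s. k s * level n s) has_integral j n) {-T..T}"
  shows "((\<lambda>s. k s * \<sigma> s) has_integral (i + M * (\<Sum>n\<in>{- trunc T..trunc T}. v (of_int n) * j n))) {-T..T}"
proof -
  have "continuous_on {-T..T} (\<lambda>s. k (- s))"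
    by (rule continuous_on_compose2[OF k]) (auto intro!: continuous_intros)
  then have "(\<lambda>s. m * k (- s) * v s) integrable_on {-T..T}"
    using solves_continuous(1)[OF sol] by (intro integrable_continuous_real continuous_intros) auto
  then obtain r where r: "((\<lambda>s. m * k (- s) * v s) has_integral r) {-T..T}" by blast
  then have r': "((\<lambda>s. m * k s * v (- s)) has_integral r) {-T..T}"
    using has_integral_reflect_real[of "\<lambda>s. m * k (- s) * v s" r T "-T"] by simp
  have "((\<lambda>s. \<Sum>n\<in>{- trunc T..trunc T}. M * (v (of_int n) * (k s * level n s))) has_integral
      (\<Sum>n\<in>{- trunc T..trunc T}. M * (v (of_int n) * j n))) {-T..T}"
    using j by (intro has_integral_sum has_integral_mult_right) auto
  from has_integral_add[OF has_integral_add[OF has_integral_diff[OF i r] r'] this]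
  have "((\<lambda>s. k s * (\<sigma> s - m * v (- s) - M * v (of_int (trunc s))) + m * k (- s) * v s - m * k (- s) * v s +
      m * k s * v (- s) + (\<Sum>n\<in>{- trunc T..trunc T}. M * (v (of_int n) * (k s * level n s)))) has_integral
      (i + M * (\<Sum>n\<in>{- trunc T..trunc T}. v (of_int n) * j n))) {-T..T}"
    by (simp add: sum_distrib_left)
  then show ?thesis
  proof (rule has_integral_eq[rotated])
    fix s assume s: "s \<in> {-T..T}"
    have "(\<Sum>n\<in>{- trunc T..trunc T}. M * (v (of_int n) * (k s * level n s))) =
      M * k s * (\<Sum>n\<in>{- trunc T..trunc T}. v (of_int n) * level n s)"
      by (simp add: sum_distrib_left algebra_simps)
    also have "\<dots> = M * k s * v (of_int (trunc s))"
      using trunc_sum_level[OF s, of "\<lambda>n. v (of_int n)"] by simp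
    finally show "k s * (\<sigma> s - m * v (- s) - M * v (of_int (trunc s))) + m * k (- s) * v s - m * k (- s) * v s +
      m * k s * v (- s) + (\<Sum>n\<in>{- trunc T..trunc T}. M * (v (of_int n) * (k s * level n s))) = k s * \<sigma> s"
      by (simp add: algebra_simps)
  qed
qed

text \<open>Green's identity is applied on both sides of the pole \<open>s = t\<close>. The terms
  with \<open>v' t\<close> cancel, and each side contributes half of \<open>v t\<close> because
  \<open>kE' m 0 = 1 / 2\<close>. By periodicity of \<open>v\<close> the outer boundary terms
  combine into \<open>homA\<close> and \<open>homB\<close>.\<close>

lemma kern_representation:
  assumes sol: "solves T m M \<sigma> v v'" and per: "v T = v (-T)" "v' T = v' (-T)" and t: "t \<in> {-T..T}"
  shows "((\<lambda>s. kern m t s * (\<sigma> s - m * v (- s) - M * v (of_int (trunc s))) + m * kern m t (- s) * v s)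
    has_integral (v t + homA T m t * v' T - homB T m t * v T)) {-T..T}"
    (is "(?f has_integral ?i) _")
proof -
  have t': "-T \<le> t" "t \<le> T" using t by auto
  have refl: "sE m (t - s) = sE m (s - t)" "sF m (t - s) = sF m (s - t)" "sF' m (t - s) = - sF' m (s - t)" for s
    using signed_parity(1)[of m "t - s"] signed_parity(2)[of m "t - s"] signed_parity(4)[of m "t - s"] by simp_all
  \<comment> \<open>Left of the pole \<open>kE\<close> replaces \<open>sE\<close>, which makes the
    kernel C^2 up to \<open>s = t\<close>; \<open>sF\<close> is C^2 by itself.\<close>
  have "((\<lambda>s. (kE m (t - s) + sF m (t + s)) * (\<sigma> s - m * v (- s) - M * v (of_int (trunc s)))
      - (- m * kF m (t - s) + - m * sE m (t + s)) * v s) has_integral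
     (((kE m (t - t) + sF m (t + t)) * v' t - (- kE' m (t - t) + sF' m (t + t)) * v t) -
      ((kE m (t - (-T)) + sF m (t + (-T))) * v' (-T) - (- kE' m (t - (-T)) + sF' m (t + (-T))) * v (-T)))) {-T..t}"
    by (rule green_identity[OF sol order_refl t'])
      (auto intro!: derivative_eq_intros kE_deriv kE'_deriv sF_deriv sF'_deriv continuous_intros)
  then have 1: "(?f has_integral
     (((kE m (t - t) + sF m (t + t)) * v' t - (- kE' m (t - t) + sF' m (t + t)) * v t) -
      ((kE m (t - (-T)) + sF m (t + (-T))) * v' (-T) - (- kE' m (t - (-T)) + sF' m (t + (-T))) * v (-T)))) {-T..t}"
    by (rule has_integral_eq[rotated]) (auto simp: kern_def signed_nonneg algebra_simps)
  have "((\<lambda>s. (kE m (s - t) + sF m (t + s)) * (\<sigma> s - m * v (- s) - M * v (of_int (trunc s)))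
      - (- m * kF m (s - t) + - m * sE m (t + s)) * v s) has_integral
     (((kE m (T - t) + sF m (t + T)) * v' T - (kE' m (T - t) + sF' m (t + T)) * v T) -
      ((kE m (t - t) + sF m (t + t)) * v' t - (kE' m (t - t) + sF' m (t + t)) * v t))) {t..T}"
    by (rule green_identity[OF sol t' order_refl])
      (auto intro!: derivative_eq_intros kE_deriv kE'_deriv sF_deriv sF'_deriv continuous_intros)
  then have 2: "(?f has_integral
     (((kE m (T - t) + sF m (t + T)) * v' T - (kE' m (T - t) + sF' m (t + T)) * v T) -
      ((kE m (t - t) + sF m (t + t)) * v' t - (kE' m (t - t) + sF' m (t + t)) * v t))) {t..T}"
  proof (rule has_integral_eq[rotated])
    fix s assume "s \<in> {t..T}"
    then have "kern m t s = kE m (s - t) + sF m (t + s)" "kern m t (- s) = sE m (t + s) + kF m (s - t)"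
      using refl[of s] by (simp_all add: kern_def signed_nonneg)
    then show "(kE m (s - t) + sF m (t + s)) * (\<sigma> s - m * v (- s) - M * v (of_int (trunc s)))
      - (- m * kF m (s - t) + - m * sE m (t + s)) * v s = ?f s" by (simp add: algebra_simps)
  qed
  have "sF m (t + (-T)) = kF m (T - t)" "sF m (t + T) = kF m (T + t)"
    "sF' m (t + (-T)) = - kF' m (T - t)" "sF' m (t + T) = kF' m (T + t)"
    using refl[of T] t' by (simp_all add: signed_nonneg add.commute)
  then have "(((kE m (t - t) + sF m (t + t)) * v' t - (- kE' m (t - t) + sF' m (t + t)) * v t) -
      ((kE m (t - (-T)) + sF m (t + (-T))) * v' (-T) - (- kE' m (t - (-T)) + sF' m (t + (-T))) * v (-T))) +
    (((kE m (T - t) + sF m (t + T)) * v' T - (kE' m (T - t) + sF' m (t + T)) * v T) -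
      ((kE m (t - t) + sF m (t + t)) * v' t - (kE' m (t - t) + sF' m (t + t)) * v t)) = ?i"
    unfolding homA_def homB_def per[symmetric] by (simp add: add.commute[of T t]) (simp add: algebra_simps)
  then show ?thesis
    using has_integral_combine[OF t' 1 2] by metis
qed

lemma continuous_on_hom_reflect:
  "continuous_on S (\<lambda>t. - m * homA T m (- t))" "continuous_on S (\<lambda>t. - m * homB T m (- t))"
  unfolding homA_def homB_def by (intro continuous_intros)+

text \<open>Here there is no pole. As \<open>homA'\<close> is even and \<open>v\<close> periodic,
  the boundary terms with \<open>v\<close> cancel; for \<open>homB\<close>, which is even itself,
  those with \<open>v'\<close> do.\<close>

lemma homA_representation:
  assumes sol: "solves T m M \<sigma> v v'" and per: "v T = v (-T)" "v' T = v' (-T)" and T: "T > 0"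
  shows "((\<lambda>s. homA T m s * (\<sigma> s - m * v (- s) - M * v (of_int (trunc s))) + m * homA T m (- s) * v s)
    has_integral (homA T m T - homA T m (-T)) * v' T) {-T..T}"
  using green_identity[OF sol order_refl _ order_refl hom_deriv(1,2) continuous_on_hom_reflect(1)] T
  by (simp add: per[symmetric] homB_eq left_diff_distrib)

lemma homB_representation:
  assumes sol: "solves T m M \<sigma> v v'" and per: "v T = v (-T)" "v' T = v' (-T)" and T: "T > 0"
  shows "((\<lambda>s. homB T m s * (\<sigma> s - m * v (- s) - M * v (of_int (trunc s))) + m * homB T m (- s) * v s)
    has_integral - (homB' T m T - homB' T m (-T)) * v T) {-T..T}"
  using green_identity[OF sol order_refl _ order_refl hom_deriv(3,4) continuous_on_hom_reflect(2)] T
  by (simp add: per[symmetric] homB_eq(1) left_diff_distrib)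

lemma solves_hom:
  "solves T m 0 (\<lambda>_. 0) (homA T m) (homA' T m)" "solves T m 0 (\<lambda>_. 0) (homB T m) (homB' T m)"
  using solves_C2[where v = "homA T m" and T = T and m = m and M = 0, OF hom_deriv(1,2) continuous_on_hom_reflect(1)]
    solves_C2[where v = "homB T m" and T = T and m = m and M = 0, OF hom_deriv(3,4) continuous_on_hom_reflect(2)]
  by simp_all

text \<open>\<open>J\<close> is the response to a single level. That its jumps are the pairings of
  the level with \<open>homA\<close> and \<open>homB\<close> lets the level terms match the
  correction of \<open>J\<close>.\<close>

lemma exists_kern_level:
  assumes "T > 0" "n \<in> {- trunc T..trunc T}"
  shows "\<exists>J J'. (\<forall>t. ((\<lambda>s. kern m t s * level n s) has_integral J t) {-T..T}) \<and>
    ((\<lambda>s. homA T m s * level n s) has_integral J T - J (-T)) {-T..T} \<and>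
    ((\<lambda>s. homB T m s * level n s) has_integral J' T - J' (-T)) {-T..T} \<and>
    solves T m 0 (level n) J J'"
proof -
  obtain \<alpha> \<beta> where ab: "\<alpha> \<le> \<beta>" "-T \<le> \<alpha>" "\<beta> \<le> T"
    and lv: "\<And>t. t \<in> {-T..T} \<Longrightarrow> t \<noteq> \<alpha> \<Longrightarrow> t \<noteq> \<beta> \<Longrightarrow> level n t = (if \<alpha> < t \<and> t < \<beta> then 1 else 0)"
    and int: "\<And>f i. (f has_integral i) {\<alpha>..\<beta>} \<Longrightarrow> ((\<lambda>s. f s * level n s) has_integral (i :: real)) {-T..T}"
    by (rule has_integral_mult_level[OF assms]) blast
  obtain L where L: "L-lipschitz_on {-T..T} (kern_ivl' m \<alpha> \<beta>)" by (rule lipschitz_kern_ivl')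
  have "solves T m 0 (level n) (kern_ivl m \<alpha> \<beta>) (kern_ivl' m \<alpha> \<beta>)"
    by (rule solves_piecewise[OF kern_ivl_deriv L, of "{\<alpha>, \<beta>}"])
      (use kern_ivl'_deriv[of _ \<alpha> \<beta>] ab lv in auto)
  then show ?thesis
    using int[OF has_integral_kern[OF ab(1)]] int[OF has_integral_homA[OF ab]] int[OF has_integral_homB[OF ab]]
    by (intro exI[of _ "kern_ivl m \<alpha> \<beta>"] exI[of _ "kern_ivl' m \<alpha> \<beta>"]) auto
qed

text \<open>The jumps of \<open>w1\<close> and \<open>w2\<close> are \<open>-1\<close> because their
  coefficients will be the jumps of the function to be repaired. The right-hand side of
  \<open>w n\<close> absorbs what the value at the integer \<open>n\<close> contributes to the
  truncation term.\<close>

locale corrected_kernel =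
  fixes T m M :: real and w1 w1' w2 w2' :: "real \<Rightarrow> real" and w w' :: "int \<Rightarrow> real \<Rightarrow> real"
  assumes T: "T > 0" and uniq: "uniquely_solvable T m M"
    and w1: "solves T m M (\<lambda>_. 0) w1 w1'" "w1 T - w1 (-T) = -1" "w1' T - w1' (-T) = 0"
    and w2: "solves T m M (\<lambda>_. 0) w2 w2'" "w2 T - w2 (-T) = 0" "w2' T - w2' (-T) = -1"
    and w: "\<And>n. n \<in> {- trunc T..trunc T} \<Longrightarrow> solves T m M (\<lambda>t. - M * level n t) (w n) (w' n)"
      "\<And>n. n \<in> {- trunc T..trunc T} \<Longrightarrow> w n T = w n (-T)"
      "\<And>n. n \<in> {- trunc T..trunc T} \<Longrightarrow> w' n T = w' n (-T)"
begin

abbreviation "N \<equiv> {- trunc T..trunc T}"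

text \<open>The coefficients are the defects of \<open>kern m t s\<close> as a function of
  \<open>t\<close>: its jump in value, its jump in slope, and its values at the integers.\<close>

definition G :: "real \<Rightarrow> real \<Rightarrow> real" where
  "G t s = kern m t s + homA T m s * w1 t + homB T m s * w2 t + (\<Sum>n\<in>N. kern m (of_int n) s * w n t)"

text \<open>The combination of \<open>w1\<close>, \<open>w2\<close> and \<open>w n\<close> repairs the boundary conditions and the term
  \<open>M v([t])\<close> at once: it turns any solution of the equation with \<open>M = 0\<close> into the periodic
  solution of the full equation.\<close>

lemma correction:
  assumes P: "solves T m 0 \<sigma> P P'" and v: "solves T m M \<sigma> v v'" "v T = v (-T)" "v' T = v' (-T)"
    and t: "t \<in> {-T..T}"
  shows "v t = P t + (P T - P (-T)) * w1 t + (P' T - P' (-T)) * w2 t + (\<Sum>n\<in>N. P (of_int n) * w n t)"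
proof -
  define c1 where "c1 = P T - P (-T)"
  define c2 where "c2 = P' T - P' (-T)"
  have a: "solves T m M (\<lambda>t. \<sigma> t + M * P (of_int (trunc t))) (\<lambda>t. P t + c1 * w1 t) (\<lambda>t. P' t + c1 * w1' t)"
    using solves_lincomb[OF solves_add_trunc_term[OF P, of M] w1(1), of 1 c1] by simp
  have b: "solves T m M (\<lambda>t. \<sigma> t + M * P (of_int (trunc t))) (\<lambda>t. P t + c1 * w1 t + c2 * w2 t)
      (\<lambda>t. P' t + c1 * w1' t + c2 * w2' t)"
    using solves_lincomb[OF a w2(1), of 1 c2] by simp
  have "solves T m M (\<lambda>t. \<Sum>n\<in>N. P (of_int n) * (- M * level n t)) (\<lambda>t. \<Sum>n\<in>N. P (of_int n) * w n t)
      (\<lambda>t. \<Sum>n\<in>N. P (of_int n) * w' n t)"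
    by (rule solves_sum) (use w in auto)
  from solves_lincomb[OF b this, of 1 1]
  have "solves T m M (\<lambda>t. \<sigma> t + M * P (of_int (trunc t)) + (\<Sum>n\<in>N. P (of_int n) * (- M * level n t)))
     (\<lambda>t. P t + c1 * w1 t + c2 * w2 t + (\<Sum>n\<in>N. P (of_int n) * w n t))
     (\<lambda>t. P' t + c1 * w1' t + c2 * w2' t + (\<Sum>n\<in>N. P (of_int n) * w' n t))" by simp
  then have sol: "solves T m M \<sigma> (\<lambda>t. P t + c1 * w1 t + c2 * w2 t + (\<Sum>n\<in>N. P (of_int n) * w n t))
     (\<lambda>t. P' t + c1 * w1' t + c2 * w2' t + (\<Sum>n\<in>N. P (of_int n) * w' n t))"
  proof (rule solves_rhs_cong)
    fix t assume t: "t \<in> {-T..T}"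
    have "(\<Sum>n\<in>N. P (of_int n) * (- M * level n t)) = - M * (\<Sum>n\<in>N. P (of_int n) * level n t)"
      by (simp add: sum_distrib_left sum_negf algebra_simps)
    also have "\<dots> = - M * P (of_int (trunc t))"
      using trunc_sum_level[OF t, of "\<lambda>n. P (of_int n)"] by simp
    finally show "\<sigma> t + M * P (of_int (trunc t)) + (\<Sum>n\<in>N. P (of_int n) * (- M * level n t)) = \<sigma> t" by simp
  qed
  have eqs: "w1 T = w1 (-T) - 1" "w1' T = w1' (-T)" "w2 T = w2 (-T)" "w2' T = w2' (-T) - 1"
    using w1 w2 by simp_all
  have "(\<Sum>n\<in>N. P (of_int n) * w n T) = (\<Sum>n\<in>N. P (of_int n) * w n (-T))"
    "(\<Sum>n\<in>N. P (of_int n) * w' n T) = (\<Sum>n\<in>N. P (of_int n) * w' n (-T))"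
    using w(2,3) by (auto intro!: sum.cong)
  then have "P T + c1 * w1 T + c2 * w2 T + (\<Sum>n\<in>N. P (of_int n) * w n T) =
      P (-T) + c1 * w1 (-T) + c2 * w2 (-T) + (\<Sum>n\<in>N. P (of_int n) * w n (-T))"
    "P' T + c1 * w1' T + c2 * w2' T + (\<Sum>n\<in>N. P (of_int n) * w' n T) =
      P' (-T) + c1 * w1' (-T) + c2 * w2' (-T) + (\<Sum>n\<in>N. P (of_int n) * w' n (-T))"
    unfolding eqs by (simp_all add: c1_def c2_def algebra_simps)
  from uniquely_solvable_unique[OF uniq v sol this t] show ?thesis by (simp add: c1_def c2_def)
qed

text \<open>Correcting a solution with right-hand side zero gives a periodic one, necessarily the
  zero function. By parity one of the two jump terms drops out in each case.\<close>

lemma correction_hom: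
  assumes "t \<in> {-T..T}"
  shows "homA T m t + (homA T m T - homA T m (-T)) * w1 t + (\<Sum>n\<in>N. homA T m (of_int n) * w n t) = 0"
    "homB T m t + (homB' T m T - homB' T m (-T)) * w2 t + (\<Sum>n\<in>N. homB T m (of_int n) * w n t) = 0"
  using correction[OF solves_hom(1) solves_0 _ _ assms] correction[OF solves_hom(2) solves_0 _ _ assms]
    homB_eq[of T m T] by simp_all

text \<open>The correction of \<open>- M * J\<close> solves the very periodic problem that
  determines \<open>w n\<close>.\<close>

lemma correction_level:
  assumes "solves T m 0 (level n) J J'" "n \<in> N" "t \<in> {-T..T}"
  shows "w n t = - M * (J t + (J T - J (-T)) * w1 t + (J' T - J' (-T)) * w2 t + (\<Sum>k\<in>N. J (of_int k) * w k t))"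
proof -
  have "solves T m 0 (\<lambda>t. - M * level n t) (\<lambda>t. - M * J t) (\<lambda>t. - M * J' t)"
    using solves_lincomb[OF assms(1,1), of "- M" 0] by simp
  from correction[OF this w(1-3)[OF assms(2)] assms(3)]
  show ?thesis by (simp add: algebra_simps sum_distrib_left sum_negf)
qed

text \<open>Such a level is a single endpoint of the interval, so the right-hand side vanishes
  almost everywhere and uniqueness applies.\<close>

lemma w_eq_0:
  assumes "n \<in> N" "\<bar>of_int n\<bar> = T" "t \<in> {-T..T}"
  shows "w n t = 0"
proof -
  obtain \<alpha> \<beta> where lv: "\<And>t. t \<in> {-T..T} \<Longrightarrow> t \<noteq> \<alpha> \<Longrightarrow> t \<noteq> \<beta> \<Longrightarrow> level n t = (if \<alpha> < t \<and> t < \<beta> then 1 else 0)"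
    and eq: "\<bar>of_int n\<bar> = T \<Longrightarrow> \<alpha> = \<beta>"
    by (rule level_interval[OF T assms(1)]) blast
  have "level n t = 0" if "t \<in> {-T..T} - {\<alpha>}" for t
    using lv[of t] eq[OF assms(2)] that by auto
  then have "solves T m M (\<lambda>t. - M * level n t) (\<lambda>_. 0) (\<lambda>_. 0)"
    by (intro solves_piecewise[of T _ _ 0 "{\<alpha>}"]) (auto intro: lipschitz_on_constant)
  from uniquely_solvable_unique[OF uniq w(1-3)[OF assms(1)] this] assms(3) show ?thesis by simp
qed

text \<open>Together the summands of \<open>G\<close> produce \<open>v t\<close> plus multiples of
  \<open>v' T\<close>, \<open>v T\<close> and the values of \<open>v\<close> at the integers. The
  coefficients of the first two are, up to sign, the left-hand sides of
  \<open>correction_hom\<close>; the values at the integers cancel by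
  \<open>correction_level\<close>.\<close>

lemma G_representation:
  assumes sol: "solves T m M \<sigma> v v'" and per: "v T = v (-T)" "v' T = v' (-T)" and t: "t \<in> {-T..T}"
  shows "((\<lambda>s. G t s * \<sigma> s) has_integral v t) {-T..T}"
proof -
  have "\<forall>n\<in>N. \<exists>J J'. (\<forall>t. ((\<lambda>s. kern m t s * level n s) has_integral J t) {-T..T}) \<and>
    ((\<lambda>s. homA T m s * level n s) has_integral J T - J (-T)) {-T..T} \<and>
    ((\<lambda>s. homB T m s * level n s) has_integral J' T - J' (-T)) {-T..T} \<and>
    solves T m 0 (level n) J J'"
    using exists_kern_level[OF T] by blast
  from bchoice[OF this] obtain J where "\<forall>n\<in>N. \<exists>J'. (\<forall>t. ((\<lambda>s. kern m t s * level n s) has_integral J n t) {-T..T}) \<and>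
    ((\<lambda>s. homA T m s * level n s) has_integral J n T - J n (-T)) {-T..T} \<and>
    ((\<lambda>s. homB T m s * level n s) has_integral J' T - J' (-T)) {-T..T} \<and>
    solves T m 0 (level n) (J n) J'" ..
  from bchoice[OF this] obtain J' where J': "\<forall>n\<in>N. (\<forall>t. ((\<lambda>s. kern m t s * level n s) has_integral J n t) {-T..T}) \<and>
    ((\<lambda>s. homA T m s * level n s) has_integral J n T - J n (-T)) {-T..T} \<and>
    ((\<lambda>s. homB T m s * level n s) has_integral J' n T - J' n (-T)) {-T..T} \<and>
    solves T m 0 (level n) (J n) (J' n)" ..
  then have J: "\<And>n t. n \<in> N \<Longrightarrow> ((\<lambda>s. kern m t s * level n s) has_integral J n t) {-T..T}"
    "\<And>n. n \<in> N \<Longrightarrow> ((\<lambda>s. homA T m s * level n s) has_integral J n T - J n (-T)) {-T..T}"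
    "\<And>n. n \<in> N \<Longrightarrow> ((\<lambda>s. homB T m s * level n s) has_integral J' n T - J' n (-T)) {-T..T}"
    "\<And>n. n \<in> N \<Longrightarrow> solves T m 0 (level n) (J n) (J' n)" by simp_all
  define a b where "a = v T" and "b = v' T"
  define dA dB where "dA = homA T m T - homA T m (-T)" and "dB = homB' T m T - homB' T m (-T)"
  have kern: "((\<lambda>s. kern m t s * \<sigma> s) has_integral (v t + homA T m t * b - homB T m t * a
      + M * (\<Sum>k\<in>N. v (of_int k) * J k t))) {-T..T}" if "t \<in> {-T..T}" for t
    unfolding a_def b_def
    by (rule integral_against_rhs[OF T sol _ kern_representation[OF sol per that] J(1)])
      (auto intro!: continuous_intros)
  have A: "((\<lambda>s. homA T m s * \<sigma> s) has_integral (dA * b + M * (\<Sum>k\<in>N. v (of_int k) * (J k T - J k (-T))))) {-T..T}"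
    unfolding b_def dA_def
    by (rule integral_against_rhs[OF T sol _ homA_representation[OF sol per T] J(2)]) (auto intro!: continuous_intros)
  have B: "((\<lambda>s. homB T m s * \<sigma> s) has_integral (- dB * a + M * (\<Sum>k\<in>N. v (of_int k) * (J' k T - J' k (-T))))) {-T..T}"
    unfolding a_def dB_def
    by (rule integral_against_rhs[OF T sol _ homB_representation[OF sol per T] J(3)]) (auto intro!: continuous_intros)
  have "((\<lambda>s. kern m t s * \<sigma> s + homA T m s * \<sigma> s * w1 t + homB T m s * \<sigma> s * w2 t
      + (\<Sum>n\<in>N. kern m (of_int n) s * \<sigma> s * w n t)) has_integral
     ((v t + homA T m t * b - homB T m t * a + M * (\<Sum>k\<in>N. v (of_int k) * J k t))
      + (dA * b + M * (\<Sum>k\<in>N. v (of_int k) * (J k T - J k (-T)))) * w1 t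
      + (- dB * a + M * (\<Sum>k\<in>N. v (of_int k) * (J' k T - J' k (-T)))) * w2 t
      + (\<Sum>n\<in>N. (v (of_int n) + homA T m (of_int n) * b - homB T m (of_int n) * a
          + M * (\<Sum>k\<in>N. v (of_int k) * J k (of_int n))) * w n t))) {-T..T}"
    by (intro has_integral_add has_integral_sum has_integral_mult_left kern A B t)
      (use of_int_in_interval[OF _ T] in auto)
  moreover have "(v t + homA T m t * b - homB T m t * a + M * (\<Sum>k\<in>N. v (of_int k) * J k t))
      + (dA * b + M * (\<Sum>k\<in>N. v (of_int k) * (J k T - J k (-T)))) * w1 t
      + (- dB * a + M * (\<Sum>k\<in>N. v (of_int k) * (J' k T - J' k (-T)))) * w2 t
      + (\<Sum>n\<in>N. (v (of_int n) + homA T m (of_int n) * b - homB T m (of_int n) * a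
          + M * (\<Sum>k\<in>N. v (of_int k) * J k (of_int n))) * w n t) = v t" (is "?L = _")
  proof -
    \<comment> \<open>The summations are exchanged so that all terms can be collected by the factor
      \<open>v (of_int k)\<close>.\<close>
    have dbl: "(\<Sum>n\<in>N. (M * (\<Sum>k\<in>N. v (of_int k) * J k (of_int n))) * w n t) =
        (\<Sum>k\<in>N. v (of_int k) * (M * (\<Sum>n\<in>N. J k (of_int n) * w n t)))"
      unfolding sum_distrib_left sum_distrib_right by (subst sum.swap) (simp add: algebra_simps)
    have lv: "(\<Sum>k\<in>N. v (of_int k) * w k t) = (\<Sum>k\<in>N. v (of_int k) *
       (- M * (J k t + (J k T - J k (-T)) * w1 t + (J' k T - J' k (-T)) * w2 t + (\<Sum>n\<in>N. J k (of_int n) * w n t))))"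
      using correction_level[OF J(4) _ t] by (intro sum.cong refl arg_cong2[of _ _ _ _ "(*)"]) auto
    have "(\<Sum>n\<in>N. (v (of_int n) + homA T m (of_int n) * b - homB T m (of_int n) * a
          + M * (\<Sum>k\<in>N. v (of_int k) * J k (of_int n))) * w n t) =
       (\<Sum>k\<in>N. v (of_int k) * w k t) + b * (\<Sum>n\<in>N. homA T m (of_int n) * w n t)
       - a * (\<Sum>n\<in>N. homB T m (of_int n) * w n t) + (\<Sum>k\<in>N. v (of_int k) * (M * (\<Sum>n\<in>N. J k (of_int n) * w n t)))"
      unfolding dbl[symmetric] sum_distrib_left[of b] sum_distrib_left[of a]
      by (simp add: algebra_simps sum.distrib sum_subtractf)
    also have "(\<Sum>k\<in>N. v (of_int k) * w k t) =
        - M * (\<Sum>k\<in>N. v (of_int k) * J k t) - M * (\<Sum>k\<in>N. v (of_int k) * (J k T - J k (-T))) * w1 t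
        - M * (\<Sum>k\<in>N. v (of_int k) * (J' k T - J' k (-T))) * w2 t
        - (\<Sum>k\<in>N. v (of_int k) * (M * (\<Sum>n\<in>N. J k (of_int n) * w n t)))"
      unfolding lv by (simp add: ring_distribs sum.distrib sum_subtractf sum_negf sum_distrib_left sum_distrib_right mult_ac)
    \<comment> \<open>With the level terms gone, only the factors of \<open>b = v' T\<close> and
      \<open>a = v T\<close> remain.\<close>
    finally have "?L = v t + b * (homA T m t + dA * w1 t + (\<Sum>n\<in>N. homA T m (of_int n) * w n t))
       - a * (homB T m t + dB * w2 t + (\<Sum>n\<in>N. homB T m (of_int n) * w n t))"
      by (simp add: algebra_simps)
    then show ?thesis
      using correction_hom[OF t] by (simp add: dA_def dB_def)
  qed
  ultimately show ?thesis
    by (simp add: G_def algebra_simps sum_distrib_left)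
qed

section \<open>Existence, uniqueness and symmetry of the Green's function\<close>

lemma continuous_on_G: "continuous_on S (G t)"
  unfolding G_def[abs_def] by (intro continuous_intros)

lemma continuous_on_G_reflect: "continuous_on S (\<lambda>s. G t (- s))"
  by (rule continuous_on_compose2[OF continuous_on_G[of UNIV]]) (auto intro!: continuous_intros)

lemma set_integral_G:
  assumes \<sigma>: "\<sigma> absolutely_integrable_on {-T..T}"
    and sol: "solves T m M \<sigma> v v'" "v T = v (-T)" "v' T = v' (-T)" and t: "t \<in> {-T..T}"
  shows "(LINT s:{-T..T}|lebesgue. G t s * \<sigma> s) = v t"
proof -
  have "(\<lambda>s. G t s * \<sigma> s) absolutely_integrable_on {-T..T}"
    using \<sigma> continuous_on_G
    by (intro absolutely_integrable_bounded_measurable_product_real)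
      (auto intro!: continuous_imp_measurable_on_sets_lebesgue compact_imp_bounded compact_continuous_image)
  from set_lebesgue_integral_eq_integral(2)[OF this] show ?thesis
    using G_representation[OF sol t] by (simp add: integral_unique)
qed

text \<open>Nothing is differentiated under the integral: a solution exists by hypothesis, and the
  integral coincides with it on the interval.\<close>

lemma G_is_greens_function: "is_greens_function T m M G"
  unfolding is_greens_function_def
proof (intro conjI ballI allI impI continuous_on_G)
  fix \<sigma> :: "real \<Rightarrow> real" assume \<sigma>: "\<sigma> absolutely_integrable_on {-T..T}"
  obtain v v' where v: "solves T m M \<sigma> v v'" "v T = v (-T)" "v' T = v' (-T)"
    by (rule uniquely_solvable_exists[OF uniq \<sigma>])
  then have "is_solution T m M \<sigma> v" by (auto simp: is_solution_iff_solves)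
  then show "is_solution T m M \<sigma> (\<lambda>t. LINT s:{-T..T}|lebesgue. G t s * \<sigma> s)"
    by (rule is_solution_cong[OF T, rotated]) (simp add: set_integral_G[OF \<sigma> v])
qed

text \<open>For fixed \<open>t\<close> the difference \<open>\<sigma> = H t - G t\<close> is itself
  taken as right-hand side. Both kernels return the same \<open>v t\<close>, so the integral of the
  square of \<open>\<sigma>\<close> vanishes, and continuity makes \<open>\<sigma>\<close>
  zero.\<close>

lemma greens_function_eq:
  assumes H: "is_greens_function T m M H" and t: "t \<in> {-T..T}" and s: "s \<in> {-T..T}"
  shows "H t s = G t s"
proof -
  define \<sigma> where "\<sigma> s = H t s - G t s" for s
  have "continuous_on {-T..T} (H t)" using H t by (simp add: is_greens_function_def)
  then have c: "continuous_on {-T..T} \<sigma>"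
    unfolding \<sigma>_def by (intro continuous_intros continuous_on_G)
  then have \<sigma>: "\<sigma> absolutely_integrable_on {-T..T}" by (rule absolutely_integrable_continuous_real)
  obtain v v' where v: "solves T m M \<sigma> v v'" "v T = v (-T)" "v' T = v' (-T)"
    by (rule uniquely_solvable_exists[OF uniq \<sigma>])
  have "is_solution T m M \<sigma> (\<lambda>t. LINT s:{-T..T}|lebesgue. H t s * \<sigma> s)"
    using H \<sigma> by (simp add: is_greens_function_def)
  then have "(LINT s:{-T..T}|lebesgue. H t s * \<sigma> s) = v t"
    unfolding is_solution_iff_solves using uniquely_solvable_unique[OF uniq _ _ _ v t] by blast
  moreover have Hi: "(\<lambda>s. H t s * \<sigma> s) absolutely_integrable_on {-T..T}"
    using \<open>continuous_on {-T..T} (H t)\<close> c by (intro absolutely_integrable_continuous_real continuous_intros)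
  ultimately have "((\<lambda>s. H t s * \<sigma> s) has_integral v t) {-T..T}"
    using has_integral_set_lebesgue[OF Hi] by simp
  from has_integral_diff[OF this G_representation[OF v t]]
  have "((\<lambda>s. \<sigma> s * \<sigma> s) has_integral 0) {-T..T}" by (simp add: \<sigma>_def left_diff_distrib)
  then have "integral {-T..T} (\<lambda>s. \<sigma> s * \<sigma> s) = 0" by (rule integral_unique)
  moreover have "continuous_on {-T..T} (\<lambda>s. \<sigma> s * \<sigma> s)" using c by (intro continuous_intros)
  ultimately have "\<forall>s\<in>{-T..T}. \<sigma> s * \<sigma> s = 0"
    using integral_eq_0_iff[of "-T" T "\<lambda>s. \<sigma> s * \<sigma> s"] T by simp
  then show ?thesis using s by (simp add: \<sigma>_def)
qed

text \<open>By the symmetry of the equation the reflected kernel is a Green's function too, and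
  uniqueness identifies the two.\<close>

lemma G_reflect:
  assumes t: "t \<in> {-T..T}" and s: "s \<in> {-T..T}"
  shows "G (- t) (- s) = G t s"
proof -
  have "is_greens_function T m M (\<lambda>t s. G (- t) (- s))"
    unfolding is_greens_function_def
  proof (intro conjI ballI allI impI)
    show "continuous_on {-T..T} (\<lambda>s. G (- t) (- s))" for t by (rule continuous_on_G_reflect)
    fix \<sigma> :: "real \<Rightarrow> real" assume \<sigma>: "\<sigma> absolutely_integrable_on {-T..T}"
    then have \<sigma>': "(\<lambda>s. \<sigma> (- s)) absolutely_integrable_on {-T..T}"
      using absolutely_integrable_reflect_real[where f = \<sigma> and a = "-T" and b = T] by simp
    obtain v v' where v: "solves T m M (\<lambda>s. \<sigma> (- s)) v v'" "v T = v (-T)" "v' T = v' (-T)"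
      by (rule uniquely_solvable_exists[OF uniq \<sigma>'])
    have sol: "is_solution T m M \<sigma> (\<lambda>t. v (- t))"
      unfolding is_solution_iff_solves using solves_reflect[OF v(1)] v(2,3) by (intro exI[of _ "\<lambda>t. - v' (- t)"]) simp
    have lint: "(LINT s:{-T..T}|lebesgue. G (- t) (- s) * \<sigma> s) = v (- t)" if "t \<in> {-T..T}" for t
    proof -
      have "((\<lambda>s. G (- t) s * \<sigma> (- s)) has_integral v (- t)) {-T..T}"
        using G_representation[OF v] that by simp
      then have "((\<lambda>s. G (- t) (- s) * \<sigma> s) has_integral v (- t)) {-T..T}"
        using has_integral_reflect_real[of "\<lambda>s. G (- t) s * \<sigma> (- s)" "v (- t)" T "-T"] by simp
      moreover have "(\<lambda>s. G (- t) (- s) * \<sigma> s) absolutely_integrable_on {-T..T}"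
        using \<sigma> continuous_on_G_reflect
        by (intro absolutely_integrable_bounded_measurable_product_real)
          (auto intro!: continuous_imp_measurable_on_sets_lebesgue compact_imp_bounded compact_continuous_image)
      ultimately show ?thesis
        using set_lebesgue_integral_eq_integral(2) integral_unique by metis
    qed
    show "is_solution T m M \<sigma> (\<lambda>t. LINT s:{-T..T}|lebesgue. G (- t) (- s) * \<sigma> s)"
      by (rule is_solution_cong[OF T lint[symmetric] sol])
  qed
  from greens_function_eq[OF this t s] show ?thesis .
qed

end

lemma exists_corrected_kernel:
  assumes "T > 0" "uniquely_solvable T m M"
  obtains w1 w1' w2 w2' w w' where "corrected_kernel T m M w1 w1' w2 w2' w w'"
proof -
  \<comment> \<open>This function falls by one across the interval and has constant slope.\<close>
  have "((\<lambda>t. - t / (2 * T)) has_real_derivative - 1 / (2 * T)) (at t within S)"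
    "((\<lambda>_. - 1 / (2 * T)) has_real_derivative 0) (at t within S)" for t S
    using assms(1) by (auto intro!: derivative_eq_intros)
  from exists_homogeneous_with_jump[OF assms this continuous_on_const]
  obtain w1 w1' where w1: "solves T m M (\<lambda>_. 0) w1 w1'" "w1 T - w1 (-T) = - T / (2 * T) - (- (- T) / (2 * T))"
    "w1' T - w1' (-T) = - 1 / (2 * T) - - 1 / (2 * T)" by metis
  \<comment> \<open>This function is even, so it has no jump in value, and its slope falls by
    one.\<close>
  have "((\<lambda>t. - t\<^sup>2 / (4 * T)) has_real_derivative - t / (2 * T)) (at t within S)"
    "((\<lambda>t. - t / (2 * T)) has_real_derivative - 1 / (2 * T)) (at t within S)" for t S
    using assms(1) by (auto intro!: derivative_eq_intros simp: field_simps)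
  from exists_homogeneous_with_jump[OF assms this continuous_on_const]
  obtain w2 w2' where w2: "solves T m M (\<lambda>_. 0) w2 w2'" "w2 T - w2 (-T) = - T\<^sup>2 / (4 * T) - (- (- T)\<^sup>2 / (4 * T))"
    "w2' T - w2' (-T) = - T / (2 * T) - (- (- T) / (2 * T))" by metis
  have "\<forall>n\<in>{- trunc T..trunc T}. \<exists>w w'. solves T m M (\<lambda>t. - M * level n t) w w' \<and> w T = w (-T) \<and> w' T = w' (-T)"
  proof
    fix n assume "n \<in> {- trunc T..trunc T}"
    then have "(\<lambda>t. - M * level n t) absolutely_integrable_on {-T..T}"
      using level_absolutely_integrable[OF assms(1)] by (intro set_integrable_mult_right) auto
    then show "\<exists>w w'. solves T m M (\<lambda>t. - M * level n t) w w' \<and> w T = w (-T) \<and> w' T = w' (-T)"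
      using uniquely_solvable_exists[OF assms(2)] by metis
  qed
  then obtain w w' where "\<And>n. n \<in> {- trunc T..trunc T} \<Longrightarrow> solves T m M (\<lambda>t. - M * level n t) (w n) (w' n) \<and>
    w n T = w n (-T) \<and> w' n T = w' n (-T)" by metis
  then have "corrected_kernel T m M w1 w1' w2 w2' w w'"
    using assms w1 w2 by unfold_locales auto
  then show thesis by (rule that)
qed

section \<open>Regularity of the Green's function\<close>

lemma sE'_tendsto_0:
  assumes "(g \<longlongrightarrow> 0) F"
  shows "\<forall>\<^sub>F x in F. g x > 0 \<Longrightarrow> ((\<lambda>x. sE' m (g x)) \<longlongrightarrow> 1 / 2) F"
    "\<forall>\<^sub>F x in F. g x < 0 \<Longrightarrow> ((\<lambda>x. sE' m (g x)) \<longlongrightarrow> - 1 / 2) F"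
proof -
  have k: "((\<lambda>x. kE' m (g x)) \<longlongrightarrow> 1 / 2) F"
    using isCont_tendsto_compose[OF isCont_kernel(3)[where m = m and x = 0] assms] by simp
  show "((\<lambda>x. sE' m (g x)) \<longlongrightarrow> 1 / 2) F" if "\<forall>\<^sub>F x in F. g x > 0"
    using k by (rule Lim_transform_eventually) (use that in \<open>eventually_elim, simp add: sE'_def\<close>)
  show "((\<lambda>x. sE' m (g x)) \<longlongrightarrow> - 1 / 2) F" if "\<forall>\<^sub>F x in F. g x < 0"
    using tendsto_minus[OF k] unfolding minus_divide_left
    by (rule Lim_transform_eventually) (use that in \<open>eventually_elim, simp add: sE'_def\<close>)
qed

lemma deriv_on_eq:
  assumes "(f has_real_derivative d) (at t within {a..b})" "a < b" "t \<in> {a..b}"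
  shows "deriv_on {a..b} f t = d"
  using vector_derivative_within_cbox[of a b t f d] assms
  by (simp add: deriv_on_def has_real_derivative_iff_has_vector_derivative)

lemma has_real_derivative_imp_differentiable:
  "(f has_real_derivative d) F \<Longrightarrow> f differentiable F"
  by (auto simp: has_field_derivative_def differentiable_def)

lemma C1_at_pointsI:
  assumes "a < b" "S \<subseteq> {a..b}" "\<And>t. t \<in> S \<Longrightarrow> (f has_real_derivative f' t) (at t within {a..b})"
    "continuous_on S f'"
  shows "C1_at_points {a..b} S f"
  unfolding C1_at_points_def
proof
  show "\<forall>t\<in>S. f differentiable at t within {a..b}"
    using assms(3) has_real_derivative_imp_differentiable by blast
  show "continuous_on S (deriv_on {a..b} f)"
    using assms(4) by (rule continuous_on_cong[THEN iffD1, rotated 2])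
      (use assms in \<open>auto intro!: deriv_on_eq[symmetric]\<close>)
qed

text \<open>Only off \<open>C\<close> is \<open>deriv_on\<close> known to agree with
  \<open>f'\<close>. As \<open>C\<close> is closed, they agree near \<open>t\<close>, which suffices
  for the derivative at \<open>t\<close>.\<close>

lemma deriv_on_has_derivative:
  assumes ab: "a < b" and C: "finite C" and t: "t \<in> {a..b} - C"
    and f: "\<And>t. t \<in> {a..b} - C \<Longrightarrow> (f has_real_derivative f' t) (at t within {a..b})"
    and f': "(f' has_real_derivative d) (at t within {a..b})"
  shows "(deriv_on {a..b} f has_real_derivative d) (at t within {a..b})"
proof -
  have "open (- C)" using C by (intro open_Compl finite_imp_closed)
  then obtain r where "r > 0" "ball t r \<subseteq> - C" using t by (meson ComplI DiffD2 openE)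
  then show ?thesis
    using f' t deriv_on_eq[OF f ab]
    by (intro has_field_derivative_transform_within[OF f' \<open>r > 0\<close>]) (auto simp: dist_commute subset_iff)
qed

text \<open>Two exceptional sets are kept apart: the first derivative is given off \<open>C\<close>,
  whereas the second is asked for on \<open>S\<close> only, which may omit further points such as
  the nonzero integers.\<close>

lemma C2_at_pointsI:
  assumes ab: "a < b" and C: "finite C" and S: "S \<subseteq> {a..b} - C"
    and f: "\<And>t. t \<in> {a..b} - C \<Longrightarrow> (f has_real_derivative f' t) (at t within {a..b})"
    and f': "\<And>t. t \<in> S \<Longrightarrow> (f' has_real_derivative f'' t) (at t within {a..b})"
    and f'': "continuous_on S f''"
  shows "C2_at_points {a..b} S f"
  unfolding C2_at_points_def
proof
  have "continuous_on S f'"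
    using S by (intro DERIV_continuous_on[of S f' f''] DERIV_subset[OF f']) auto
  then show "C1_at_points {a..b} S f"
    using S f by (intro C1_at_pointsI[OF ab]) auto
  show "C1_at_points {a..b} S (deriv_on {a..b} f)"
    using S by (intro C1_at_pointsI[OF ab _ deriv_on_has_derivative[OF ab C _ f f'] f'']) auto
qed

section \<open>Partial derivatives of the corrected kernel, their boundary values and jumps\<close>

context corrected_kernel
begin

definition G_t :: "real \<Rightarrow> real \<Rightarrow> real" where
  "G_t t s = sE' m (t - s) + sF' m (t + s) + homA T m s * w1' t + homB T m s * w2' t
    + (\<Sum>n\<in>N. kern m (of_int n) s * w' n t)"

definition G_s :: "real \<Rightarrow> real \<Rightarrow> real" where
  "G_s t s = - sE' m (t - s) + sF' m (t + s) + homA' T m s * w1 t + homB' T m s * w2 t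
    + (\<Sum>n\<in>N. (- sE' m (of_int n - s) + sF' m (of_int n + s)) * w n t)"

lemma w_deriv:
  assumes "t \<in> {-T..T}"
  shows "(w1 has_real_derivative w1' t) (at t within {-T..T})"
    "(w2 has_real_derivative w2' t) (at t within {-T..T})"
    "n \<in> N \<Longrightarrow> (w n has_real_derivative w' n t) (at t within {-T..T})"
  using w1(1) w2(1) w(1)[of n] assms by (simp_all add: solves_def)

lemma w'_deriv:
  assumes t: "t \<in> {-T..T}" "t \<notin> D_set T - {0}"
  shows "(w1' has_real_derivative - m * w1 (- t) - M * w1 (of_int (trunc t))) (at t within {-T..T})"
    "(w2' has_real_derivative - m * w2 (- t) - M * w2 (of_int (trunc t))) (at t within {-T..T})"
    "n \<in> N \<Longrightarrow> (w' n has_real_derivative - M * level n t - m * w n (- t) - M * w n (of_int (trunc t))) (at t within {-T..T})"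
  \<comment> \<open>\<open>level n\<close> depends on \<open>t\<close> through
    \<open>trunc t\<close> alone, so it is continuous wherever truncation is locally
    constant.\<close>
  using solves_second_derivative[OF w1(1) t] solves_second_derivative[OF w2(1) t]
    solves_second_derivative[OF w(1) t] continuous_within_trunc[OF t, of _ "\<lambda>k. - M * (if k = n then 1 else 0)"]
  by (simp_all add: level_def[abs_def])

lemma G_deriv_t:
  assumes t: "t \<in> {-T..T}" "t \<noteq> s"
  shows "((\<lambda>t. G t s) has_real_derivative G_t t s) (at t within {-T..T})"
  unfolding G_def G_t_def
  by (intro DERIV_add DERIV_cmult DERIV_sum kern_deriv_t w_deriv t)

lemma G_deriv_tt:
  assumes t: "t \<in> {-T..T}" "t \<noteq> s" "t \<notin> D_set T - {0}"
  shows "((\<lambda>t. G_t t s) has_real_derivative - m * G (- t) s - M * G (of_int (trunc t)) s) (at t within {-T..T})"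
proof -
  have D: "((\<lambda>t. G_t t s) has_real_derivative - m * kern m (- t) s
      + homA T m s * (- m * w1 (- t) - M * w1 (of_int (trunc t)))
      + homB T m s * (- m * w2 (- t) - M * w2 (of_int (trunc t)))
      + (\<Sum>n\<in>N. kern m (of_int n) s * (- M * level n t - m * w n (- t) - M * w n (of_int (trunc t)))))
      (at t within {-T..T})"
    unfolding G_t_def
    by (intro DERIV_add[OF DERIV_add[OF DERIV_add[OF kern_deriv_tt]]] DERIV_cmult DERIV_sum w'_deriv t)
  \<comment> \<open>The right-hand sides of the \<open>w n\<close> add up to
    \<open>- M * kern m (of_int (trunc t)) s\<close>, the summand that completes
    \<open>- M * G (of_int (trunc t)) s\<close>.\<close>
  have sum: "(\<Sum>n\<in>N. kern m (of_int n) s * (- M * level n t - m * w n (- t) - M * w n (of_int (trunc t)))) =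
      - M * kern m (of_int (trunc t)) s - m * (\<Sum>n\<in>N. kern m (of_int n) s * w n (- t))
      - M * (\<Sum>n\<in>N. kern m (of_int n) s * w n (of_int (trunc t)))"
    unfolding trunc_sum_level[OF t(1), of "\<lambda>n. kern m (of_int n) s"] sum_distrib_left
    by (simp add: algebra_simps sum.distrib sum_subtractf sum_negf)
  from D[unfolded sum] show ?thesis
    by (simp add: G_def algebra_simps)
qed

text \<open>The second hypothesis also covers the endpoints \<open>s = T\<close> and \<open>s = -T\<close> when \<open>T\<close> is an
  integer, where \<open>w n\<close> vanishes.\<close>

lemma G_deriv_s:
  assumes ts: "t \<noteq> s" and n: "\<And>n. n \<in> N \<Longrightarrow> of_int n = s \<Longrightarrow> w n t = 0"
  shows "((\<lambda>s. G t s) has_real_derivative G_s t s) (at s within S)"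
proof -
  have summand: "((\<lambda>s. kern m (of_int n) s * w n t) has_real_derivative
      (- sE' m (of_int n - s) + sF' m (of_int n + s)) * w n t) (at s within S)" if "n \<in> N" for n
  proof (cases "of_int n = s")
    case True
    then show ?thesis using n that by simp
  next
    case False
    then show ?thesis by (intro DERIV_cmult_right kern_deriv_s)
  qed
  show ?thesis
    unfolding G_def G_s_def
    by (rule DERIV_add, intro DERIV_add DERIV_cmult_right kern_deriv_s hom_deriv ts, rule DERIV_sum, rule summand)
qed

lemma G_deriv_ss:
  assumes ts: "t \<noteq> s" and n: "s \<notin> D_set T"
  shows "((\<lambda>s. G_s t s) has_real_derivative - m * G t (- s)) (at s within S)"
proof -
  have "of_int n \<noteq> s" if "n \<in> N" for n using n that by (auto simp: D_set_def)
  then have "((\<lambda>s. G_s t s) has_real_derivative - m * kern m t (- s) + (- m * homA T m (- s)) * w1 t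
      + (- m * homB T m (- s)) * w2 t + (\<Sum>n\<in>N. (- m * kern m (of_int n) (- s)) * w n t)) (at s within S)"
    unfolding G_s_def
    by (intro DERIV_add[OF DERIV_add[OF DERIV_add[OF kern_deriv_ss]]] DERIV_cmult_right DERIV_sum hom_deriv kern_deriv_ss ts)
  then show ?thesis by (simp add: G_def algebra_simps sum_distrib_left)
qed

lemma continuous_on_w:
  "continuous_on {-T..T} w1" "continuous_on {-T..T} w2" "n \<in> N \<Longrightarrow> continuous_on {-T..T} (w n)"
  "continuous_on {-T..T} w1'" "continuous_on {-T..T} w2'" "n \<in> N \<Longrightarrow> continuous_on {-T..T} (w' n)"
  using solves_continuous w1(1) w2(1) w(1) by blast+

lemma continuous_on_G_fst: "continuous_on {-T..T} (\<lambda>t. G t s)"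
  unfolding G_def by (intro continuous_intros continuous_on_w) auto

lemma continuous_on_G_tt:
  assumes "S \<subseteq> {-T..T} - (D_set T - {0})"
  shows "continuous_on S (\<lambda>t. - m * G (- t) s - M * G (of_int (trunc t)) s)"
proof -
  have "continuous_on {-T..T} (\<lambda>t. G (- t) s)"
    by (rule continuous_on_compose2[OF continuous_on_G_fst]) (auto intro!: continuous_intros)
  then have "continuous_on S (\<lambda>t. G (- t) s)" using assms by (auto intro: continuous_on_subset)
  moreover have "continuous_on S (\<lambda>t. G (of_int (trunc t)) s)"
    unfolding continuous_on_eq_continuous_within
    using continuous_within_trunc[of _ T S "\<lambda>n. G (of_int n) s"] assms by blast
  ultimately show ?thesis by (intro continuous_intros)
qed

text \<open>The jump \<open>homA T m s\<close> of the kernel is removed by the jump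
  \<open>-1\<close> of \<open>w1\<close>.\<close>

lemma G_periodic_t:
  assumes s: "\<bar>s\<bar> \<le> T"
  shows "G T s = G (- T) s"
proof -
  have sum: "(\<Sum>n\<in>N. kern m (of_int n) s * w n T) = (\<Sum>n\<in>N. kern m (of_int n) s * w n (-T))"
    using w(2) by (auto intro!: sum.cong)
  have kern: "kern m T s = homA T m s + kern m (- T) s"
    unfolding homA_kern[OF s] by (simp add: kern_commute[of m s])
  have jumps: "w1 T = w1 (- T) - 1" "w2 T = w2 (- T)" using w1 w2 by simp_all
  show ?thesis unfolding G_def sum kern jumps by (simp add: algebra_simps)
qed

text \<open>The same cancellation for slopes, with \<open>homB\<close> and \<open>w2\<close>.
  Strictness keeps \<open>sE'\<close> away from the origin.\<close>

lemma G_t_periodic: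
  assumes s: "\<bar>s\<bar> < T"
  shows "G_t T s = G_t (- T) s"
proof -
  have sum: "(\<Sum>n\<in>N. kern m (of_int n) s * w' n T) = (\<Sum>n\<in>N. kern m (of_int n) s * w' n (-T))"
    using w(3) by (auto intro!: sum.cong)
  have "sE' m (- T - s) = - kE' m (T + s)" "sF' m (- T + s) = - kF' m (T - s)"
    using signed_parity(3)[of m "T + s"] signed_parity(4)[of m "T - s"] s by (simp_all add: signed_nonneg)
  then have kern: "sE' m (T - s) + sF' m (T + s) = sE' m (- T - s) + sF' m (- T + s) + homB T m s"
    using s by (simp add: homB_def signed_nonneg)
  have jumps: "w1' T = w1' (- T)" "w2' T = w2' (- T) - 1" using w1 w2 by simp_all
  show ?thesis unfolding G_t_def sum kern jumps by (simp add: algebra_simps)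
qed

text \<open>The corrections repair the behaviour in \<open>t\<close>, not in \<open>s\<close>. Yet
  the jumps of the summands in \<open>s\<close> add up to the first expression in
  \<open>correction_hom\<close>, which is zero.\<close>

lemma G_periodic_s: "t \<in> {-T..T} \<Longrightarrow> G t T = G t (- T)"
proof -
  assume t: "t \<in> {-T..T}"
  have "kern m (of_int n) T = kern m (of_int n) (- T) + homA T m (of_int n)" if "n \<in> N" for n
    using homA_kern[of "of_int n" T m] of_int_in_interval[OF that T] by auto
  then have "(\<Sum>n\<in>N. kern m (of_int n) T * w n t) =
      (\<Sum>n\<in>N. kern m (of_int n) (- T) * w n t) + (\<Sum>n\<in>N. homA T m (of_int n) * w n t)"
    by (simp add: sum.distrib[symmetric] algebra_simps)
  moreover have "kern m t T = kern m t (- T) + homA T m t" using homA_kern[of t T m] t by auto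
  ultimately show ?thesis
    using correction_hom(1)[OF t] homB_eq(1)[of T m T] by (simp add: G_def algebra_simps)
qed

lemma kern_deriv_s_jump:
  assumes "\<bar>t\<bar> < T"
  shows "- sE' m (t - T) + sF' m (t + T) = - sE' m (t + T) + sF' m (t - T) + homB T m t"
  using signed_parity(3)[of m "T - t"] signed_parity(4)[of m "T - t"] assms
  by (simp add: homB_def signed_nonneg add.commute[of t T])

lemma G_s_periodic: "\<bar>t\<bar> < T \<Longrightarrow> G_s t T = G_s t (- T)"
proof -
  assume t: "\<bar>t\<bar> < T"
  then have t': "t \<in> {-T..T}" by auto
  have "(- sE' m (of_int n - T) + sF' m (of_int n + T)) * w n t =
     (- sE' m (of_int n + T) + sF' m (of_int n - T)) * w n t + homB T m (of_int n) * w n t" if "n \<in> N" for n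
  proof (cases "\<bar>of_int n\<bar> = T")
    case True
    then show ?thesis using w_eq_0[OF that _ t'] by simp
  next
    case False
    then have "\<bar>of_int n\<bar> < T" using of_int_in_interval[OF that T] by auto
    then show ?thesis unfolding kern_deriv_s_jump[OF \<open>\<bar>of_int n\<bar> < T\<close>] by (simp add: distrib_right)
  qed
  then have "(\<Sum>n\<in>N. (- sE' m (of_int n - T) + sF' m (of_int n + T)) * w n t) =
     (\<Sum>n\<in>N. (- sE' m (of_int n + T) + sF' m (of_int n - T)) * w n t) + (\<Sum>n\<in>N. homB T m (of_int n) * w n t)"
    by (simp add: sum.distrib[symmetric])
  then show ?thesis
    using kern_deriv_s_jump[OF t] correction_hom(2)[OF t'] homB_eq(2)[of T m T]
    by (simp add: G_s_def algebra_simps)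
qed

lemma G_t_limits:
  assumes t: "\<bar>t\<bar> < T"
  obtains c where "((\<lambda>\<tau>. G_t \<tau> t) \<longlongrightarrow> c - 1 / 2) (at_left t)" "((\<lambda>s. G_t t s) \<longlongrightarrow> c - 1 / 2) (at_right t)"
    "((\<lambda>s. G_t t s) \<longlongrightarrow> c + 1 / 2) (at_left t)" "((\<lambda>\<tau>. G_t \<tau> t) \<longlongrightarrow> c + 1 / 2) (at_right t)"
proof -
  \<comment> \<open>\<open>R\<close> collects what is continuous across the diagonal; its value
    there is the constant \<open>c\<close>, and the jump stems from \<open>sE'\<close>
    alone.\<close>
  define R where "R t s = sF' m (t + s) + homA T m s * w1' t + homB T m s * w2' t
    + (\<Sum>n\<in>N. kern m (of_int n) s * w' n t)" for t s
  have G: "G_t t s = sE' m (t - s) + R t s" for t s by (simp add: G_t_def R_def)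
  have "continuous_on {-T..T} (\<lambda>\<tau>. R \<tau> t)"
    unfolding R_def by (intro continuous_intros continuous_on_w) auto
  then have "isCont (\<lambda>\<tau>. R \<tau> t) t"
    using t by (intro continuous_on_interior[of "{-T..T}"]) (auto simp: interior_atLeastAtMost_real)
  moreover have "continuous_on UNIV (R t)"
    unfolding R_def[abs_def] by (intro continuous_intros)
  then have "isCont (R t) t" by (simp add: continuous_on_eq_continuous_at)
  ultimately have lim: "((\<lambda>\<tau>. R \<tau> t) \<longlongrightarrow> R t t) (at t within S)" "(R t \<longlongrightarrow> R t t) (at t within S)" for S
    unfolding isCont_def by (auto intro: tendsto_mono[OF at_le])
  have d: "((\<lambda>\<tau>. \<tau> - t) \<longlongrightarrow> 0) (at t within S)" "((\<lambda>s. t - s) \<longlongrightarrow> 0) (at t within S)" for S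
    by (auto intro!: tendsto_eq_intros)
  show thesis
  proof (rule that[of "R t t"])
    show "((\<lambda>\<tau>. G_t \<tau> t) \<longlongrightarrow> R t t - 1 / 2) (at_left t)"
      using tendsto_add[OF sE'_tendsto_0(2)[OF d(1)] lim(1)] unfolding G by (simp add: eventually_at_filter)
    show "((\<lambda>s. G_t t s) \<longlongrightarrow> R t t - 1 / 2) (at_right t)"
      using tendsto_add[OF sE'_tendsto_0(2)[OF d(2)] lim(2)] unfolding G by (simp add: eventually_at_filter)
    show "((\<lambda>s. G_t t s) \<longlongrightarrow> R t t + 1 / 2) (at_left t)"
      using tendsto_add[OF sE'_tendsto_0(1)[OF d(2)] lim(2)] unfolding G by (simp add: eventually_at_filter add.commute)
    show "((\<lambda>\<tau>. G_t \<tau> t) \<longlongrightarrow> R t t + 1 / 2) (at_right t)"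
      using tendsto_add[OF sE'_tendsto_0(1)[OF d(1)] lim(1)] unfolding G by (simp add: eventually_at_filter add.commute)
  qed
qed

section \<open>Transfer to an arbitrary Green's function\<close>

context
  fixes H :: "real \<Rightarrow> real \<Rightarrow> real"
  assumes H: "is_greens_function T m M H"
begin

lemma H_eq: "t \<in> {-T..T} \<Longrightarrow> s \<in> {-T..T} \<Longrightarrow> H t s = G t s"
  by (rule greens_function_eq[OF H])

lemma H_deriv_t:
  assumes "t \<in> {-T..T}" "s \<in> {-T..T}" "t \<noteq> s"
  shows "((\<lambda>t. H t s) has_real_derivative G_t t s) (at t within {-T..T})"
  using G_deriv_t[OF assms(1,3)] assms(1) by (rule has_real_derivative_cong_on) (use assms in \<open>auto simp: H_eq\<close>)

lemma H_deriv_s: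
  assumes "t \<in> {-T..T}" "s \<in> {-T..T}" "t \<noteq> s" "\<And>n. n \<in> N \<Longrightarrow> of_int n = s \<Longrightarrow> w n t = 0"
  shows "((\<lambda>s. H t s) has_real_derivative G_s t s) (at s within {-T..T})"
  using G_deriv_s[OF assms(3,4)] assms(2) by (rule has_real_derivative_cong_on) (use assms in \<open>auto simp: H_eq\<close>)

lemma partial_t_eq: "t \<in> {-T..T} \<Longrightarrow> s \<in> {-T..T} \<Longrightarrow> t \<noteq> s \<Longrightarrow> partial_t T H t s = G_t t s"
  unfolding partial_t_def using H_deriv_t T by (intro deriv_on_eq) auto

lemma H_regular_t:
  assumes s: "s \<in> {-T..T}"
  shows "continuous_on {-T..T} (\<lambda>t. H t s)" "C1_at_points {-T..T} ({-T..T} - {s}) (\<lambda>t. H t s)"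
    "C2_at_points {-T..T} ({-T..T} - {s} - (D_set T - {0})) (\<lambda>t. H t s)"
proof -
  show "continuous_on {-T..T} (\<lambda>t. H t s)"
    using continuous_on_G_fst by (rule continuous_on_cong[THEN iffD1, rotated 2]) (use s in \<open>auto simp: H_eq\<close>)
  have "continuous_on ({-T..T} - {s}) (\<lambda>t. G_t t s)"
    unfolding G_t_def using continuous_on_w
    by (intro continuous_intros) (auto intro: continuous_on_subset)
  then show "C1_at_points {-T..T} ({-T..T} - {s}) (\<lambda>t. H t s)"
    using T H_deriv_t s by (intro C1_at_pointsI) auto
  show "C2_at_points {-T..T} ({-T..T} - {s} - (D_set T - {0})) (\<lambda>t. H t s)"
    using T H_deriv_t[OF _ s] G_deriv_tt[of _ s]
    by (intro C2_at_pointsI[OF _ _ _ _ _ continuous_on_G_tt[of _ s], of _ _ "{s}"]) auto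
qed

lemma H_equation_t:
  assumes "s \<in> {-T..T}" "t \<in> {-T..T}" "t \<noteq> s" "t \<notin> D_set T - {0}"
  shows "partial_t T (partial_t T H) t s + m * H (- t) s + M * H (of_int (trunc t)) s = 0"
proof -
  have "(deriv_on {-T..T} (\<lambda>t. H t s) has_real_derivative - m * G (- t) s - M * G (of_int (trunc t)) s)
      (at t within {-T..T})"
    using T H_deriv_t[OF _ assms(1)] G_deriv_tt[OF assms(2,3,4)] assms
    by (intro deriv_on_has_derivative[of _ _ "{s}"]) auto
  from deriv_on_eq[OF this] show ?thesis
    using T assms of_int_trunc_in_interval[OF assms(2)] by (simp add: partial_t_def[abs_def] H_eq)
qed

lemma H_regular_s:
  assumes t: "t \<in> {-T..T}"
  shows "C2_at_points {-T..T} ({-T..T} - D_set_at T t) (\<lambda>s. H t s)"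
proof (rule C2_at_pointsI[of _ _ "insert t (D_set T)"])
  fix s assume s: "s \<in> {-T..T} - insert t (D_set T)"
  then show "((\<lambda>s. H t s) has_real_derivative G_s t s) (at s within {-T..T})"
    by (intro H_deriv_s t) (auto simp: D_set_def)
next
  fix s assume "s \<in> {-T..T} - D_set_at T t"
  then show "(G_s t has_real_derivative - m * G t (- s)) (at s within {-T..T})"
    by (intro G_deriv_ss) (auto simp: D_set_at_def)
next
  show "continuous_on ({-T..T} - D_set_at T t) (\<lambda>s. - m * G t (- s))"
    by (intro continuous_intros continuous_on_G_reflect)
qed (use T in \<open>auto simp: D_set_at_def D_set_def\<close>)

lemma H_equation_s:
  assumes t: "t \<in> {-T..T}" and s: "s \<in> {-T..T}" "s \<notin> D_set_at T t"
  shows "partial_s T (partial_s T H) t s + m * H t (- s) = 0"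
proof -
  have "((\<lambda>s. H t s) has_real_derivative G_s t s) (at s within {-T..T})" if "s \<in> {-T..T} - insert t (D_set T)" for s
    using that by (intro H_deriv_s t) (auto simp: D_set_def)
  moreover have "(G_s t has_real_derivative - m * G t (- s)) (at s within {-T..T})"
    using s by (intro G_deriv_ss) (auto simp: D_set_at_def)
  ultimately have "(deriv_on {-T..T} (\<lambda>s. H t s) has_real_derivative - m * G t (- s)) (at s within {-T..T})"
    using s T by (intro deriv_on_has_derivative[of _ _ "insert t (D_set T)" s]) (auto simp: D_set_at_def D_set_def)
  from deriv_on_eq[OF this] show ?thesis
    using T s t by (simp add: partial_s_def[abs_def] H_eq)
qed

lemma H_jump:
  assumes t: "t \<in> {-T<..<T}"
  shows "\<exists>a b. ((\<lambda>\<tau>. partial_t T H \<tau> t) \<longlongrightarrow> a) (at_left t) \<and> ((\<lambda>s. partial_t T H t s) \<longlongrightarrow> a) (at_right t) \<and>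
    ((\<lambda>s. partial_t T H t s) \<longlongrightarrow> b) (at_left t) \<and> ((\<lambda>\<tau>. partial_t T H \<tau> t) \<longlongrightarrow> b) (at_right t) \<and> b - a = 1"
proof -
  have "\<bar>t\<bar> < T" using t by auto
  then obtain c where c: "((\<lambda>\<tau>. G_t \<tau> t) \<longlongrightarrow> c - 1 / 2) (at_left t)" "((\<lambda>s. G_t t s) \<longlongrightarrow> c - 1 / 2) (at_right t)"
    "((\<lambda>s. G_t t s) \<longlongrightarrow> c + 1 / 2) (at_left t)" "((\<lambda>\<tau>. G_t \<tau> t) \<longlongrightarrow> c + 1 / 2) (at_right t)"
    by (rule G_t_limits)
  have l: "\<forall>\<^sub>F x in at_left t. G_t x t = partial_t T H x t" "\<forall>\<^sub>F x in at_left t. G_t t x = partial_t T H t x"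
    using t by (auto intro!: eventually_mono[OF eventually_at_left_real[of "-T" t]] simp: partial_t_eq)
  have r: "\<forall>\<^sub>F x in at_right t. G_t x t = partial_t T H x t" "\<forall>\<^sub>F x in at_right t. G_t t x = partial_t T H t x"
    using t by (auto intro!: eventually_mono[OF eventually_at_right_real[of t T]] simp: partial_t_eq)
  show ?thesis
    using Lim_transform_eventually[OF c(1) l(1)] Lim_transform_eventually[OF c(2) r(2)]
      Lim_transform_eventually[OF c(3) l(2)] Lim_transform_eventually[OF c(4) r(1)]
    by (intro exI[of _ "c - 1 / 2"] exI[of _ "c + 1 / 2"]) simp
qed

lemma H_periodic_t:
  assumes s: "s \<in> {-T<..<T}"
  shows "H T s = H (-T) s" "(\<lambda>t. H t s) differentiable (at T within {-T..T})"
    "(\<lambda>t. H t s) differentiable (at (-T) within {-T..T})" "partial_t T H T s = partial_t T H (-T) s"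
proof -
  have TT: "T \<in> {-T..T}" "-T \<in> {-T..T}" "s \<in> {-T..T}" "T \<noteq> s" "- T \<noteq> s" "\<bar>s\<bar> < T" using s T by auto
  show "H T s = H (-T) s" using TT G_periodic_t[of s] by (simp add: H_eq)
  show "partial_t T H T s = partial_t T H (-T) s" using TT G_t_periodic by (simp add: partial_t_eq)
  show "(\<lambda>t. H t s) differentiable (at T within {-T..T})" "(\<lambda>t. H t s) differentiable (at (-T) within {-T..T})"
    using H_deriv_t[OF TT(1,3,4)] H_deriv_t[OF TT(2,3,5)] by (auto intro: has_real_derivative_imp_differentiable)
qed

lemma H_periodic_s:
  assumes t: "t \<in> {-T<..<T}"
  shows "H t T = H t (-T)" "(\<lambda>s. H t s) differentiable (at T within {-T..T})"
    "(\<lambda>s. H t s) differentiable (at (-T) within {-T..T})" "partial_s T H t T = partial_s T H t (-T)"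
proof -
  have TT: "t \<in> {-T..T}" "T \<in> {-T..T}" "-T \<in> {-T..T}" "t \<noteq> T" "t \<noteq> - T" "\<bar>t\<bar> < T" using t T by auto
  have d: "((\<lambda>s. H t s) has_real_derivative G_s t T) (at T within {-T..T})"
    "((\<lambda>s. H t s) has_real_derivative G_s t (-T)) (at (-T) within {-T..T})"
    using TT T by (auto intro!: H_deriv_s w_eq_0)
  show "H t T = H t (-T)" using TT G_periodic_s[of t] by (simp add: H_eq)
  show "(\<lambda>s. H t s) differentiable (at T within {-T..T})" "(\<lambda>s. H t s) differentiable (at (-T) within {-T..T})"
    using d by (auto intro: has_real_derivative_imp_differentiable)
  show "partial_s T H t T = partial_s T H t (-T)"
    unfolding partial_s_def using deriv_on_eq[OF d(1)] deriv_on_eq[OF d(2)] TT T G_s_periodic by simp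
qed

end

end

theorem proposition4p6:
  fixes T m M :: real
  assumes "T > 0" and "uniquely_solvable T m M"
  shows "(\<exists>H. is_greens_function T m M H) \<and>
    (\<forall>H. is_greens_function T m M H \<longrightarrow>
      (\<forall>H'. is_greens_function T m M H' \<longrightarrow> (\<forall>t\<in>{-T..T}. \<forall>s\<in>{-T..T}. H' t s = H t s)) \<and>
      \<comment> \<open>1\<close>
      (\<forall>s\<in>{-T..T}.
        continuous_on {-T..T} (\<lambda>t. H t s) \<and>
        C1_at_points {-T..T} ({-T..T} - {s}) (\<lambda>t. H t s) \<and>
        C2_at_points {-T..T} ({-T..T} - {s} - (D_set T - {0})) (\<lambda>t. H t s)) \<and>
      \<comment> \<open>2\<close>
      (\<forall>t\<in>{-T..T}.
        continuous_on {-T..T} (\<lambda>s. H t s) \<and>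
        C2_at_points {-T..T} ({-T..T} - D_set_at T t) (\<lambda>s. H t s)) \<and>
      \<comment> \<open>3\<close>
      (\<forall>s\<in>{-T<..<T}. \<forall>t\<in>{-T..T}. t \<noteq> s \<and> t \<notin> D_set T - {0} \<longrightarrow>
        partial_t T (partial_t T H) t s + m * H (- t) s + M * H (of_int (trunc t)) s = 0) \<and>
      \<comment> \<open>4\<close>
      (\<forall>t\<in>{-T<..<T}. t \<notin> D_set T \<longrightarrow>
        (\<exists>a b :: real.
          ((\<lambda>\<tau>. partial_t T H \<tau> t) \<longlongrightarrow> a) (at_left t) \<and>
          ((\<lambda>s. partial_t T H t s) \<longlongrightarrow> a) (at_right t) \<and>
          ((\<lambda>s. partial_t T H t s) \<longlongrightarrow> b) (at_left t) \<and>
          ((\<lambda>\<tau>. partial_t T H \<tau> t) \<longlongrightarrow> b) (at_right t) \<and>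
          b - a = 1)) \<and>
      \<comment> \<open>5\<close>
      (\<forall>s\<in>{-T<..<T}.
        H T s = H (-T) s \<and>
        (\<lambda>t. H t s) differentiable (at T within {-T..T}) \<and>
        (\<lambda>t. H t s) differentiable (at (-T) within {-T..T}) \<and>
        partial_t T H T s = partial_t T H (-T) s) \<and>
      \<comment> \<open>6\<close>
      (\<forall>t\<in>{-T<..<T}.
        H t T = H t (-T) \<and>
        (\<lambda>s. H t s) differentiable (at T within {-T..T}) \<and>
        (\<lambda>s. H t s) differentiable (at (-T) within {-T..T}) \<and>
        partial_s T H t T = partial_s T H t (-T)) \<and>
      \<comment> \<open>7\<close>
      (\<forall>t\<in>{-T..T}. \<forall>s\<in>{-T..T}. H t s = H (- t) (- s)) \<and>
      \<comment> \<open>8\<close>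
      (\<forall>t\<in>{-T..T}. \<forall>s\<in>{-T..T}. s \<notin> D_set_at T t \<longrightarrow>
        partial_s T (partial_s T H) t s + m * H t (- s) = 0))"
proof -
  obtain w1 w1' w2 w2' w w' where "corrected_kernel T m M w1 w1' w2 w2' w w'"
    by (rule exists_corrected_kernel[OF assms])
  then interpret corrected_kernel T m M w1 w1' w2 w2' w w' .
  show ?thesis
  proof (intro conjI exI[of _ G] G_is_greens_function allI impI ballI)
    fix H assume H: "is_greens_function T m M H"
    show "H' t s = H t s" if "is_greens_function T m M H'" "t \<in> {-T..T}" "s \<in> {-T..T}" for H' t s
      using H_eq[OF that] H_eq[OF H that(2,3)] by simp
    show "continuous_on {-T..T} (\<lambda>s. H t s)" if "t \<in> {-T..T}" for t
      using H that by (simp add: is_greens_function_def)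
    show "H t s = H (- t) (- s)" if "t \<in> {-T..T}" "s \<in> {-T..T}" for t s
      using H_eq[OF H] G_reflect that by simp
    show "partial_t T (partial_t T H) t s + m * H (- t) s + M * H (of_int (trunc t)) s = 0"
      if "s \<in> {-T<..<T}" "t \<in> {-T..T}" "t \<noteq> s \<and> t \<notin> D_set T - {0}" for s t
      using H_equation_t[OF H, of s t] that by auto
  qed (blast intro: H_regular_t H_regular_s H_jump H_periodic_t H_periodic_s H_equation_s)+
qed

end
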